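(* Let $p$ be a prime, $A$ a pro-$p$ group and $P$ a prosoluble projective group. Then the free profinite product $G=A\amalg P$ admits a prosoluble retract isomorphic to the free prosoluble product $G_s=A\amalg^s P$.
   Context: All groups are profinite, subgroups are closed, homomorphisms are continuous. A profinite group is projective if it is projective in the category of profinite groups. $A\amalg P$ denotes the coproduct of $A$ and $P$ in the category of profinite groups, and $A\amalg^sP$ their coproduct in the category of prosoluble groups. A retract of $G$ is a closed subgroup $R\le G$ for which there is a continuous homomorphism $G\to R$ that is the identity on $R$. *)

theory Defs
  imports "HOL-Analysis.Analysis" "HOL-Algebra.Solvable_Groups" "HOL-Computational_Algebra.Primes"
begin

text \<open>The type variable 'u below plays the role of a universe: the category of profinite groups is
  the category of all profinite groups whose carrier is a set of elements of type 'u.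
  If 'u is infinite, it contains a copy of every finite group. Since profinite groups are inverse
  limits of finite groups, the universal property of a coproduct (of profinite or of prosoluble
  groups) and the lifting property of a projective group can be tested on finite groups, and so
  these notions do not depend on the choice of 'u.\<close>

record 'u top_group = "'u monoid" +
  topo :: "'u topology"

locale topological_group = group G for G :: "'u top_group" (structure) +
  assumes topspace_topo: "topspace (topo G) = carrier G"
    and continuous_mult:
      "continuous_map (prod_topology (topo G) (topo G)) (topo G) (\<lambda>(x, y). x \<otimes> y)"
    and continuous_inv: "continuous_map (topo G) (topo G) (\<lambda>x. inv x)"

locale profinite_group = topological_group G for G :: "'u top_group" (structure) +
  assumes compact: "compact_space (topo G)"
    and Hausdorff: "Hausdorff_space (topo G)"
    and totally_disconnected: "connectedin (topo G) S \<Longrightarrow> \<exists>a. S \<subseteq> {a}"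

definition prosoluble_group :: "'u top_group \<Rightarrow> bool" where
  "prosoluble_group G \<longleftrightarrow> profinite_group G \<and>
     (\<forall>N. N \<lhd> G \<and> openin (topo G) N \<longrightarrow> finite (carrier (G Mod N)) \<and> solvable (G Mod N))"

definition pro_p_group :: "nat \<Rightarrow> 'u top_group \<Rightarrow> bool" where
  "pro_p_group p G \<longleftrightarrow> profinite_group G \<and>
     (\<forall>N. N \<lhd> G \<and> openin (topo G) N \<longrightarrow>
        finite (carrier (G Mod N)) \<and> (\<exists>k. order (G Mod N) = p ^ k))"

text \<open>As for \<^term>\<open>hom\<close>, values outside the carrier are irrelevant, so equality of
  homomorphisms is always equality on the carrier.\<close>

definition cont_hom :: "'u top_group \<Rightarrow> 'u top_group \<Rightarrow> ('u \<Rightarrow> 'u) set" where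
  "cont_hom G H = {h \<in> hom G H. continuous_map (topo G) (topo H) h}"

definition top_iso :: "'u top_group \<Rightarrow> 'u top_group \<Rightarrow> bool" where
  "top_iso G H \<longleftrightarrow> (\<exists>h \<in> iso G H. homeomorphic_map (topo G) (topo H) h)"

definition projective_group :: "'u top_group \<Rightarrow> bool" where
  "projective_group P \<longleftrightarrow> profinite_group P \<and>
     (\<forall>B C \<alpha> \<phi>. profinite_group B \<and> profinite_group C \<and>
        \<alpha> \<in> cont_hom B C \<and> \<alpha> ` carrier B = carrier C \<and> \<phi> \<in> cont_hom P C \<longrightarrow>
        (\<exists>\<psi> \<in> cont_hom P B. \<forall>x \<in> carrier P. \<alpha> (\<psi> x) = \<phi> x))"

text \<open>\<open>(G, i, j)\<close> is a coproduct of \<open>A\<close> and \<open>B\<close> in the full subcategory of topological groups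
  given by \<open>\<C>\<close>.\<close>

definition is_coproduct ::
  "('u top_group \<Rightarrow> bool) \<Rightarrow> 'u top_group \<Rightarrow> 'u top_group \<Rightarrow>
   'u top_group \<Rightarrow> ('u \<Rightarrow> 'u) \<Rightarrow> ('u \<Rightarrow> 'u) \<Rightarrow> bool" where
  "is_coproduct \<C> A B G i j \<longleftrightarrow>
     \<C> A \<and> \<C> B \<and> \<C> G \<and> i \<in> cont_hom A G \<and> j \<in> cont_hom B G \<and>
     (\<forall>H f g. \<C> H \<and> f \<in> cont_hom A H \<and> g \<in> cont_hom B H \<longrightarrow>
        (\<exists>\<phi> \<in> cont_hom G H.
           (\<forall>a \<in> carrier A. \<phi> (i a) = f a) \<and> (\<forall>b \<in> carrier B. \<phi> (j b) = g b) \<and>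
           (\<forall>\<psi> \<in> cont_hom G H.
              (\<forall>a \<in> carrier A. \<psi> (i a) = f a) \<and> (\<forall>b \<in> carrier B. \<psi> (j b) = g b) \<longrightarrow>
              (\<forall>x \<in> carrier G. \<psi> x = \<phi> x))))"

definition closed_subgroup :: "'u set \<Rightarrow> 'u top_group \<Rightarrow> bool" where
  "closed_subgroup R G \<longleftrightarrow> subgroup R G \<and> closedin (topo G) R"

definition sub_top_group :: "'u top_group \<Rightarrow> 'u set \<Rightarrow> 'u top_group" where
  "sub_top_group G R = G\<lparr>carrier := R, topo := subtopology (topo G) R\<rparr>"

definition retract_of_group :: "'u set \<Rightarrow> 'u top_group \<Rightarrow> bool" where
  "retract_of_group R G \<longleftrightarrow> closed_subgroup R G \<and>
     (\<exists>r \<in> cont_hom G (sub_top_group G R). \<forall>x \<in> R. r x = x)"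

end

theory Submission
  imports Defs "HOL-Algebra.Group_Action" "HOL-Algebra.Sylow"
begin

text \<open>Let \<open>\<pi> : G \<rightarrow> G\<^sub>s\<close> be the canonical map, which is onto, and let \<open>S \<le> G\<close> be minimal among the
  closed subgroups that contain the image of \<open>A\<close> and satisfy \<open>\<pi>(S) = G\<^sub>s\<close>. Then \<open>S\<close> is prosoluble.
  Indeed, a finite quotient \<open>B\<close> of \<open>S\<close> is an extension of a soluble group by a kernel \<open>K\<close>, and no
  proper subgroup of \<open>B\<close> that contains the image of \<open>A\<close> supplements \<open>K\<close>. As that image is a
  \<open>p\<close>-group, it normalises a nontrivial Sylow subgroup of every nontrivial normal section of \<open>K\<close>; by
  the Frattini argument the normaliser is a supplement, hence everything, so \<open>K\<close> is soluble.
  Since \<open>P\<close> is projective, \<open>P \<rightarrow> G\<^sub>s\<close> lifts to \<open>S\<close>, and the universal property of \<open>G\<^sub>s\<close> among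
  prosoluble groups yields a section \<open>\<sigma> : G\<^sub>s \<rightarrow> S\<close> of \<open>\<pi>\<close>. The retract is the image of \<open>\<sigma>\<close>.\<close>

section \<open>Sylow subgroups and supplements in finite groups\<close>

text \<open>Elements of \<open>BijGroup X\<close> are extensional, hence the
  \<open>restrict\<close>. Each \<open>f g\<close> is bijective because \<open>f (inv g)\<close>
  inverts it.\<close>

lemma (in group) group_action_restrict:
  assumes closed: "\<And>g x. g \<in> carrier G \<Longrightarrow> x \<in> X \<Longrightarrow> f g x \<in> X"
    and one: "\<And>x. x \<in> X \<Longrightarrow> f \<one> x = x"
    and mult: "\<And>g h x. g \<in> carrier G \<Longrightarrow> h \<in> carrier G \<Longrightarrow> x \<in> X \<Longrightarrow> f (g \<otimes> h) x = f g (f h x)"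
  shows "group_action G X (\<lambda>g. restrict (f g) X)"
proof -
  have Bij: "restrict (f g) X \<in> Bij X" if "g \<in> carrier G" for g
  proof -
    have "f (inv g) (f g x) = x" "f g (f (inv g) x) = x" if "x \<in> X" for x
      using mult[of "inv g" g x] mult[of g "inv g" x] \<open>g \<in> carrier G\<close> that one by auto
    then have "bij_betw (f g) X X"
      using closed that by (intro bij_betw_byWitness[where f' = "f (inv g)"]) auto
    then show ?thesis
      by (simp add: Bij_def cong: bij_betw_cong)
  qed
  show ?thesis
    unfolding group_action_def
  proof (intro group_hom.intro group_hom_axioms.intro homI)
    fix g h assume "g \<in> carrier G" "h \<in> carrier G"
    with Bij closed mult
    show "restrict (f (g \<otimes> h)) X = restrict (f g) X \<otimes>\<^bsub>BijGroup X\<^esub> restrict (f h) X"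
      by (auto simp: BijGroup_def compose_def restrict_def fun_eq_iff)
  qed (use Bij is_group group_BijGroup in \<open>auto simp: BijGroup_def\<close>)
qed

text \<open>The size of an orbit divides \<open>p ^ n\<close>, so an orbit is either a single fixed
  point or has size divisible by \<open>p\<close>; modulo \<open>p\<close> only the fixed points
  count.\<close>

lemma (in group_action) card_fixed_points_cong:
  assumes p: "Factorial_Ring.prime p" and order: "order G = p ^ n" and fin: "finite E"
  shows "card E mod p = card {x \<in> E. \<forall>g \<in> carrier G. \<phi> g x = x} mod p"
proof -
  interpret group G using group_hom group_hom.axioms(1) by blast
  let ?F = "{x \<in> E. \<forall>g \<in> carrier G. \<phi> g x = x}"
  let ?O = "orbits G E \<phi>"
  have sub: "orb \<subseteq> E" if "orb \<in> ?O" for orb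
    using that orbits_coverture by auto
  have finO: "finite ?O"
    using fin by (simp add: orbits_def)
  have "card E = (\<Sum>orb\<in>?O. \<Sum>x\<in>orb. 1)"
    by (subst disjoint_sum[OF fin]) simp
  also have "\<dots> = (\<Sum>orb\<in>?O. card orb)" by simp
  finally have E: "card E = (\<Sum>orb\<in>?O. card orb)" .
  \<comment> \<open>The fixed points are counted by an indicator summed over the same orbits, so
    that the two counts can be compared orbit by orbit.\<close>
  have "card ?F = (\<Sum>x\<in>E. if x \<in> ?F then 1 else 0)"
    using card_as_sums[of ?F E "\<lambda>x. x \<in> ?F"] fin by auto
  also have "\<dots> = (\<Sum>orb\<in>?O. \<Sum>x\<in>orb. if x \<in> ?F then 1 else 0)"
    by (subst disjoint_sum[OF fin]) simp
  finally have F: "card ?F = (\<Sum>orb\<in>?O. \<Sum>x\<in>orb. if x \<in> ?F then 1 else 0)" .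
  have "card orb mod p = (\<Sum>x\<in>orb. if x \<in> ?F then 1 else 0) mod p" if orb: "orb \<in> ?O" for orb
  proof -
    obtain x where x: "x \<in> E" "orb = orbit G \<phi> x"
      using orb by (auto simp: orbits_def)
    have finorb: "finite orb" using sub[OF orb] fin finite_subset by blast
    show ?thesis
    proof (cases "orb \<inter> ?F = {}")
      case False
      then obtain y where y: "y \<in> orb" "y \<in> ?F" by blast
      then have "x \<in> orbit G \<phi> y" using x orbit_sym by auto
      then have "x = y" using y by (auto simp: orbit_def)
      then have "orb = {y}" using y x by (auto simp: orbit_def)
      then show ?thesis using y by simp
    next
      case True
      have "card orb dvd p ^ n"
        using orbit_stabilizer_theorem[OF x(1)] x(2) order by (metis dvd_triv_left)
      then obtain k where k: "card orb = p ^ k"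
        using p divides_primepow_nat by blast
      have "k \<noteq> 0"
      proof
        assume "k = 0"
        then obtain y where y: "orb = {y}" using k by (auto simp: card_1_singleton_iff)
        then have "y = x" using x orbit_refl by (metis singletonD)
        then have "x \<in> ?F" using y x by (auto simp: orbit_def)
        then show False using True y \<open>y = x\<close> by auto
      qed
      then have "p dvd card orb" using k by simp
      moreover have "(\<Sum>x\<in>orb. if x \<in> ?F then 1 else 0) = (0::nat)"
        using True by (intro sum.neutral) auto
      ultimately show ?thesis by simp
    qed
  qed
  then have "(\<Sum>orb\<in>?O. card orb mod p) mod p = (\<Sum>orb\<in>?O. (\<Sum>x\<in>orb. if x \<in> ?F then 1 else 0) mod p) mod p"
    by (rule arg_cong[where f = "\<lambda>n. n mod p", OF sum.cong[OF refl]])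
  then have "(\<Sum>orb\<in>?O. card orb) mod p = (\<Sum>orb\<in>?O. \<Sum>x\<in>orb. if x \<in> ?F then 1 else 0) mod p"
    unfolding mod_sum_eq .
  then show ?thesis unfolding E F .
qed

section \<open>Conjugation of subgroups, Sylow subgroups and the Frattini argument\<close>

definition conj_set :: "('a, 'b) monoid_scheme \<Rightarrow> 'a \<Rightarrow> 'a set \<Rightarrow> 'a set" where
  "conj_set G g H = (\<lambda>x. g \<otimes>\<^bsub>G\<^esub> x \<otimes>\<^bsub>G\<^esub> inv\<^bsub>G\<^esub> g) ` H"

context group
begin

lemma conj_set_one: "H \<subseteq> carrier G \<Longrightarrow> conj_set G \<one> H = H"
  by (force simp: conj_set_def)

lemma conj_set_mult:
  assumes "g \<in> carrier G" "h \<in> carrier G" "H \<subseteq> carrier G"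
  shows "conj_set G (g \<otimes> h) H = conj_set G g (conj_set G h H)"
proof -
  have "g \<otimes> h \<otimes> x \<otimes> inv (g \<otimes> h) = g \<otimes> (h \<otimes> x \<otimes> inv h) \<otimes> inv g" if "x \<in> H" for x
    using assms that by (simp add: inv_mult_group m_assoc subset_iff)
  then show ?thesis
    unfolding conj_set_def image_image by (intro image_cong) auto
qed

lemma conj_inj: "g \<in> carrier G \<Longrightarrow> inj_on (\<lambda>x. g \<otimes> x \<otimes> inv g) (carrier G)"
  by (auto simp: inj_on_def)

lemma card_conj_set: "g \<in> carrier G \<Longrightarrow> H \<subseteq> carrier G \<Longrightarrow> card (conj_set G g H) = card H"
  unfolding conj_set_def by (intro card_image inj_on_subset[OF conj_inj])

lemma conj_set_subgroup:
  assumes g: "g \<in> carrier G" and H: "subgroup H G" shows "subgroup (conj_set G g H) G"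
proof -
  have inv_cancel: "inv g \<otimes> (g \<otimes> z) = z" if "z \<in> carrier G" for z
    using g that by (simp flip: m_assoc)
  have "(\<lambda>x. g \<otimes> x \<otimes> inv g) \<in> hom G G"
    using g inv_cancel by (auto simp: hom_def m_assoc)
  then interpret h: group_hom G G "\<lambda>x. g \<otimes> x \<otimes> inv g"
    by (simp add: group_hom_def group_hom_axioms_def is_group)
  show ?thesis unfolding conj_set_def using h.subgroup_img_is_subgroup[OF H] .
qed

lemma conj_set_inv_eq:
  assumes "g \<in> carrier G" "H \<subseteq> carrier G" "conj_set G g H = H'"
  shows "conj_set G (inv g) H' = H"
  using assms conj_set_mult[of "inv g" g H] conj_set_one by force

lemma subgroup_conj_stabilizer:
  assumes H: "H \<subseteq> carrier G"
  shows "subgroup {g \<in> carrier G. conj_set G g H = H} G"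
proof
  show "inv x \<in> {g \<in> carrier G. conj_set G g H = H}" if "x \<in> {g \<in> carrier G. conj_set G g H = H}" for x
    using that conj_set_inv_eq H by auto
qed (auto simp: H conj_set_mult conj_set_one)

text \<open>\<open>A\<close> acts on \<open>X\<close> by conjugation, and the number of fixed points
  is congruent to \<open>card X\<close>, hence nonzero, modulo \<open>p\<close>.\<close>

lemma p_group_fixes_conj_set:
  assumes p: "Factorial_Ring.prime p" and A: "subgroup A G" "card A = p ^ n"
    and X: "finite X" "\<not> p dvd card X" "X \<subseteq> Pow (carrier G)"
    and closed: "\<And>a H. a \<in> A \<Longrightarrow> H \<in> X \<Longrightarrow> conj_set G a H \<in> X"
  obtains H where "H \<in> X" "\<And>a. a \<in> A \<Longrightarrow> conj_set G a H = H"
proof -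
  interpret A: group "G\<lparr>carrier := A\<rparr>" using A subgroup_imp_group by blast
  have AG: "A \<subseteq> carrier G" using A subgroup.subset by blast
  interpret act: group_action "G\<lparr>carrier := A\<rparr>" X "\<lambda>a. restrict (conj_set G a) X"
  proof (rule A.group_action_restrict)
  qed (use closed X conj_set_mult conj_set_one AG in \<open>auto simp: subset_iff\<close>)
  have "order (G\<lparr>carrier := A\<rparr>) = p ^ n" using A by (simp add: order_def)
  from act.card_fixed_points_cong[OF p this X(1)]
  have "{x \<in> X. \<forall>g\<in>carrier (G\<lparr>carrier := A\<rparr>). restrict (conj_set G g) X x = x} \<noteq> {}"
    using X(2) by (metis card.empty mod_0 dvd_eq_mod_eq_0)
  then show ?thesis using that by auto
qed

text \<open>\<open>R\<close> acts by translation on the \<open>m\<close> right cosets of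
  \<open>Q\<close>. As \<open>q\<close> does not divide \<open>m\<close>, some coset
  \<open>Q #> x\<close> is fixed; then the conjugate of \<open>R\<close> by \<open>x\<close> lies in
  \<open>Q\<close>, and the orders agree.\<close>

lemma sylow_conjugate:
  assumes fin: "finite (carrier G)" and q: "Factorial_Ring.prime q"
    and Q: "subgroup Q G" "card Q = q ^ a" and R: "subgroup R G" "card R = q ^ a"
    and ord: "order G = q ^ a * m" "\<not> q dvd m"
  obtains g where "g \<in> carrier G" "conj_set G g R = Q"
proof -
  interpret R: group "G\<lparr>carrier := R\<rparr>" using R subgroup_imp_group by blast
  have RG: "R \<subseteq> carrier G" and QG: "Q \<subseteq> carrier G" using R Q subgroup.subset by blast+
  have inv_R: "inv g \<in> R" if "g \<in> R" for g using that R subgroup.m_inv_closed by metis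
  let ?X = "rcosets Q"
  have XG: "C \<subseteq> carrier G" if "C \<in> ?X" for C
    using that QG r_coset_subset_G by (auto simp: RCOSETS_def)
  \<comment> \<open>The inverse turns right translation into a left action.\<close>
  interpret act: group_action "G\<lparr>carrier := R\<rparr>" ?X "\<lambda>g. restrict (\<lambda>C. C #> inv g) ?X"
  proof (rule R.group_action_restrict)
    show "C #> inv g \<in> ?X" if "g \<in> carrier (G\<lparr>carrier := R\<rparr>)" "C \<in> ?X" for g C
      using that RG QG by (auto simp: RCOSETS_def coset_mult_assoc subset_iff)
    show "C #> inv \<one>\<^bsub>G\<lparr>carrier := R\<rparr>\<^esub> = C" if "C \<in> ?X" for C
      using XG that by simp
    show "C #> inv (g \<otimes>\<^bsub>G\<lparr>carrier := R\<rparr>\<^esub> h) = C #> inv h #> inv g"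
      if "g \<in> carrier (G\<lparr>carrier := R\<rparr>)" "h \<in> carrier (G\<lparr>carrier := R\<rparr>)" "C \<in> ?X" for g h C
      using that RG XG by (simp add: inv_mult_group coset_mult_assoc subset_iff)
  qed
  have "q ^ a > 0" using q by (simp add: prime_gt_0_nat)
  have "card ?X * q ^ a = m * q ^ a" using lagrange[OF Q(1)] Q(2) ord by (simp add: mult.commute)
  with \<open>q ^ a > 0\<close> have "card ?X = m" by (metis mult_right_cancel less_not_refl)
  then have "\<not> q dvd card ?X" using ord by simp
  moreover have "finite ?X" using fin by (simp add: RCOSETS_def)
  moreover have "order (G\<lparr>carrier := R\<rparr>) = q ^ a" using R by (simp add: order_def)
  ultimately have "{C \<in> ?X. \<forall>g\<in>carrier (G\<lparr>carrier := R\<rparr>). restrict (\<lambda>C. C #> inv g) ?X C = C} \<noteq> {}"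
    using act.card_fixed_points_cong[OF q] by (metis card.empty mod_0 dvd_eq_mod_eq_0)
  then obtain C where C: "C \<in> ?X" "\<And>g. g \<in> R \<Longrightarrow> C #> inv g = C" by auto
  then obtain x where x: "x \<in> carrier G" "C = Q #> x" by (auto simp: RCOSETS_def)
  have "conj_set G x R \<subseteq> Q"
  proof
    fix y assume "y \<in> conj_set G x R"
    then obtain g where g: "g \<in> R" "y = x \<otimes> g \<otimes> inv x" by (auto simp: conj_set_def)
    then have gG: "g \<in> carrier G" using RG by auto
    have "C #> g = C" using C(2)[OF inv_R[OF g(1)]] gG by simp
    then have "Q #> (x \<otimes> g) = Q #> x" using x gG QG by (simp add: coset_mult_assoc)
    then have "Q #> (x \<otimes> g \<otimes> inv x) = Q"
      using x gG QG coset_mult_inv2 by (metis coset_mult_assoc coset_mult_one inv_closed m_closed r_inv)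
    then show "y \<in> Q" using g x gG coset_join1[OF _ _ Q(1)] by auto
  qed
  moreover have "card (conj_set G x R) = card Q" using card_conj_set x RG R Q by simp
  moreover have "finite Q" using fin QG finite_subset by blast
  ultimately have "conj_set G x R = Q" using card_subset_eq by metis
  then show ?thesis using that x by blast
qed

lemma conj_set_subset_normal:
  assumes "K \<lhd> G" "g \<in> carrier G" "H \<subseteq> K" shows "conj_set G g H \<subseteq> K"
  using normal.inv_op_closed2[OF assms(1,2)] assms(3) by (auto simp: conj_set_def)

text \<open>\<open>Q\<close> is a Sylow subgroup of \<open>K\<close>. Its conjugate by
  \<open>g\<close> is another one, so some \<open>k\<close> in \<open>K\<close> conjugates
  \<open>Q\<close> to the same subgroup and \<open>inv k \<otimes> g\<close> normalises
  \<open>Q\<close>. The last conclusion thus says that the normaliser of \<open>Q\<close>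
  supplements \<open>K\<close>.\<close>

lemma invariant_sylow_frattini:
  assumes fin: "finite (carrier G)" and K: "K \<lhd> G" "K \<noteq> {\<one>}"
    and p: "Factorial_Ring.prime p" and A: "subgroup A G" "card A = p ^ n"
  obtains q a Q where "Factorial_Ring.prime q" "subgroup Q G" "Q \<subseteq> K" "card Q = q ^ a" "a \<noteq> 0"
    "\<And>x. x \<in> A \<Longrightarrow> conj_set G x Q = Q"
    "\<And>g. g \<in> carrier G \<Longrightarrow> \<exists>k\<in>K. conj_set G (inv k \<otimes> g) Q = Q"
proof -
  have Ks: "subgroup K G" using K normal_imp_subgroup by blast
  then have KG: "K \<subseteq> carrier G" using subgroup.subset by blast
  interpret K: group "G\<lparr>carrier := K\<rparr>" using Ks subgroup_imp_group by blast
  have finK: "finite K" using fin KG finite_subset by blast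
  have conjK: "conj_set (G\<lparr>carrier := K\<rparr>) k = conj_set G k" if "k \<in> K" for k
    using that Ks by (auto simp: conj_set_def m_inv_consistent fun_eq_iff)
  have subK: "subgroup H (G\<lparr>carrier := K\<rparr>) \<longleftrightarrow> subgroup H G \<and> H \<subseteq> K" for H
  proof
    assume H: "subgroup H (G\<lparr>carrier := K\<rparr>)"
    then show "subgroup H G \<and> H \<subseteq> K"
      using incl_subgroup[OF Ks H] subgroup.subset[OF H] by simp
  qed (use Ks subgroup_incl in blast)
  have cardK: "card K > 1"
  proof -
    have "\<one> \<in> K" using Ks subgroup.one_closed by blast
    then have "{\<one>} \<subset> K" using K(2) by blast
    then show ?thesis using psubset_card_mono[OF finK, of "{\<one>}"] by simp
  qed
  \<comment> \<open>Choosing \<open>q = p\<close> whenever \<open>p\<close> divides the order of \<open>K\<close> makes the number of Sylow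
    \<open>q\<close>-subgroups of \<open>K\<close> prime to \<open>p\<close>, so that \<open>A\<close> fixes one of them.\<close>
  obtain q where q: "Factorial_Ring.prime q" "q dvd card K" "p dvd card K \<Longrightarrow> q = p"
    using p cardK by (metis less_numeral_extra(4) prime_factor_nat)
  define a where "a = multiplicity q (card K)"
  obtain m where m: "card K = q ^ a * m" "\<not> q dvd m"
    using multiplicity_decompose'[of "card K" q] q(1) cardK unfolding a_def
    by (metis gr0I not_prime_unit less_nat_zero_code)
  have "a \<noteq> 0" using m q(2) by (metis mult_1 power_0)
  have ordK: "order (G\<lparr>carrier := K\<rparr>) = q ^ a * m" using m by (simp add: order_def)
  obtain Q0 where Q0: "subgroup Q0 (G\<lparr>carrier := K\<rparr>)" "card Q0 = q ^ a"
    using sylow_thm[OF q(1) K.group_axioms ordK] finK by auto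
  \<comment> \<open>\<open>X\<close> is the set of Sylow \<open>q\<close>-subgroups of
    \<open>K\<close>. \<open>K\<close> permutes it transitively, and normality of \<open>K\<close>
    makes it stable under all of \<open>G\<close>.\<close>
  define X where "X = {H. subgroup H G \<and> H \<subseteq> K \<and> card H = q ^ a}"
  have XK: "H \<subseteq> K" if "H \<in> X" for H using that by (simp add: X_def)
  have Q0X: "Q0 \<in> X" using Q0 subK by (simp add: X_def)
  have conj: "\<exists>k\<in>K. conj_set G k H = H'" if HH: "H \<in> X" "H' \<in> X" for H H'
  proof -
    obtain g where "g \<in> carrier (G\<lparr>carrier := K\<rparr>)" "conj_set (G\<lparr>carrier := K\<rparr>) g H = H'"
      by (rule K.sylow_conjugate[OF _ q(1) _ _ _ _ ordK m(2), of H' H])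
        (use HH finK subK X_def in auto)
    then show ?thesis using conjK by auto
  qed
  have closed: "conj_set G g H \<in> X" if "g \<in> carrier G" "H \<in> X" for g H
    using that conj_set_subgroup card_conj_set conj_set_subset_normal[OF K(1)] KG
    unfolding X_def by (auto dest: subgroup.subset)
  have finX: "finite X" using finK by (auto simp: X_def intro: finite_subset[of _ "Pow K"])
  interpret act: group_action "G\<lparr>carrier := K\<rparr>" X "\<lambda>a. restrict (conj_set G a) X"
  proof (rule K.group_action_restrict)
    show "conj_set G g H \<in> X" if "g \<in> carrier (G\<lparr>carrier := K\<rparr>)" "H \<in> X" for g H
      using that closed KG by auto
    show "conj_set G \<one>\<^bsub>G\<lparr>carrier := K\<rparr>\<^esub> H = H" if "H \<in> X" for H
      using conj_set_one[of H] XK[OF that] KG by auto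
    show "conj_set G (g \<otimes>\<^bsub>G\<lparr>carrier := K\<rparr>\<^esub> h) H = conj_set G g (conj_set G h H)"
      if "g \<in> carrier (G\<lparr>carrier := K\<rparr>)" "h \<in> carrier (G\<lparr>carrier := K\<rparr>)" "H \<in> X" for g h H
      using conj_set_mult[of g h H] XK[OF that(3)] that KG by auto
  qed
  let ?\<phi> = "\<lambda>a. restrict (conj_set G a) X"
  \<comment> \<open>By transitivity \<open>card X\<close> is the index in \<open>K\<close> of the
    stabiliser of \<open>Q0\<close>. The stabiliser contains \<open>Q0\<close>, so its order is a
    multiple of \<open>q ^ a\<close> and \<open>card X\<close> divides \<open>m\<close>.\<close>
  have "orbit (G\<lparr>carrier := K\<rparr>) ?\<phi> Q0 = X"
  proof
    show "orbit (G\<lparr>carrier := K\<rparr>) ?\<phi> Q0 \<subseteq> X"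
      using act.element_image Q0X by (auto simp: orbit_def)
    show "X \<subseteq> orbit (G\<lparr>carrier := K\<rparr>) ?\<phi> Q0"
    proof
      fix H assume "H \<in> X"
      then obtain k where "k \<in> K" "conj_set G k Q0 = H" using conj[OF Q0X] by blast
      then show "H \<in> orbit (G\<lparr>carrier := K\<rparr>) ?\<phi> Q0" using Q0X by (auto simp: orbit_def)
    qed
  qed
  then have card_X: "card X * card (stabilizer (G\<lparr>carrier := K\<rparr>) ?\<phi> Q0) = q ^ a * m"
    using act.orbit_stabilizer_theorem[OF Q0X] ordK by simp
  have stab: "subgroup (stabilizer (G\<lparr>carrier := K\<rparr>) ?\<phi> Q0) (G\<lparr>carrier := K\<rparr>)"
    by (rule act.stabilizer_subgroup[OF Q0X])
  have "Q0 \<subseteq> stabilizer (G\<lparr>carrier := K\<rparr>) ?\<phi> Q0"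
  proof
    fix x assume x: "x \<in> Q0"
    have s: "subgroup Q0 G" "Q0 \<subseteq> K" using Q0 subK by auto
    have "conj_set G x Q0 \<subseteq> Q0"
      using s x unfolding conj_set_def
      by (auto intro!: subgroup.m_closed[OF s(1)] subgroup.m_inv_closed[OF s(1)])
    moreover have "card (conj_set G x Q0) = card Q0" using x s KG by (intro card_conj_set) auto
    moreover have "finite Q0" using s finK finite_subset by blast
    ultimately have "conj_set G x Q0 = Q0" using card_subset_eq by metis
    then show "x \<in> stabilizer (G\<lparr>carrier := K\<rparr>) ?\<phi> Q0"
      using x s Q0X by (auto simp: stabilizer_def)
  qed
  then have "subgroup Q0 (G\<lparr>carrier := K, carrier := stabilizer (G\<lparr>carrier := K\<rparr>) ?\<phi> Q0\<rparr>)"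
    using K.subgroup_incl[OF Q0(1) stab] by simp
  from group.lagrange[OF K.subgroup_imp_group[OF stab], OF this]
  have "q ^ a dvd card (stabilizer (G\<lparr>carrier := K\<rparr>) ?\<phi> Q0)"
    using Q0(2) by (simp add: order_def) (metis dvd_triv_right)
  then obtain l where "card (stabilizer (G\<lparr>carrier := K\<rparr>) ?\<phi> Q0) = q ^ a * l" by blast
  with card_X have "q ^ a * (card X * l) = q ^ a * m" by (simp add: mult_ac)
  then have m': "card X * l = m" using q(1) by (simp add: prime_gt_0_nat)
  \<comment> \<open>Otherwise \<open>p\<close> divides \<open>m\<close>, hence
    \<open>card K\<close>, which forces \<open>q = p\<close>; but \<open>q\<close> does not divide
    \<open>m\<close>.\<close>
  have "\<not> p dvd card X"
  proof
    assume "p dvd card X"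
    then have "p dvd m" using m' by auto
    then show False using m q(3) by auto
  qed
  then obtain Q where Q: "Q \<in> X" "\<And>x. x \<in> A \<Longrightarrow> conj_set G x Q = Q"
    using p_group_fixes_conj_set[OF p A finX, of thesis] closed A subgroup.subset[OF A(1)] XK KG by blast
  have "\<exists>k\<in>K. conj_set G (inv k \<otimes> g) Q = Q" if g: "g \<in> carrier G" for g
  proof -
    have QG: "Q \<subseteq> carrier G" using Q XK KG by blast
    obtain k where k: "k \<in> K" "conj_set G k Q = conj_set G g Q"
      using conj[OF Q(1) closed[OF g Q(1)]] by auto
    then have "conj_set G (inv k) (conj_set G g Q) = Q"
      using conj_set_inv_eq[of k Q] KG QG by auto
    then have "conj_set G (inv k \<otimes> g) Q = Q"
      using conj_set_mult[of "inv k" g Q] k KG g QG by auto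
    then show ?thesis using k by blast
  qed
  then show ?thesis using that[of q Q a] q Q \<open>a \<noteq> 0\<close> by (auto simp: X_def)
qed

text \<open>\<open>Z\<close> is the centre of \<open>Q\<close>, and conjugation by elements of
  \<open>G\<close> preserves it along with \<open>Q\<close>. It is also the fixed point set of
  \<open>Q\<close> acting on itself by conjugation, so \<open>q\<close> divides
  \<open>card Z\<close>.\<close>

lemma normal_p_subgroup_center:
  assumes q: "Factorial_Ring.prime q" and Q: "Q \<lhd> G" "card Q = q ^ a" "a \<noteq> 0"
  defines "Z \<equiv> {x \<in> Q. \<forall>y\<in>Q. x \<otimes> y = y \<otimes> x}"
  shows "Z \<lhd> G" "Z \<noteq> {\<one>}"
proof -
  have Qs: "subgroup Q G" using Q normal_imp_subgroup by blast
  then have QG: "Q \<subseteq> carrier G" using subgroup.subset by blast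
  interpret Q: group "G\<lparr>carrier := Q\<rparr>" using Qs subgroup_imp_group by blast
  have QC: "y \<in> carrier G" if "y \<in> Q" for y using that QG by auto
  have ZQ: "x \<in> Q" if "x \<in> Z" for x using that unfolding Z_def by blast
  have Zcomm: "x \<otimes> y = y \<otimes> x" if "x \<in> Z" "y \<in> Q" for x y using that unfolding Z_def by blast
  have one: "\<one> \<in> Z" using Qs QC by (auto simp: Z_def subgroup.one_closed)
  show "Z \<lhd> G"
  proof (rule normal_invI)
    show "subgroup Z G"
    proof
      show "x \<otimes> y \<in> Z" if "x \<in> Z" "y \<in> Z" for x y
      proof -
        have "x \<otimes> y \<otimes> z = z \<otimes> (x \<otimes> y)" if "z \<in> Q" for z
        proof -
          have "x \<in> carrier G" "y \<in> carrier G" "z \<in> carrier G" "x \<otimes> z = z \<otimes> x" "y \<otimes> z = z \<otimes> y"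
            using \<open>x \<in> Z\<close> \<open>y \<in> Z\<close> that QC ZQ Zcomm by blast+
          then show ?thesis by (metis m_assoc)
        qed
        moreover have "x \<otimes> y \<in> Q" using that ZQ Qs by (blast intro: subgroup.m_closed)
        ultimately show ?thesis unfolding Z_def by blast
      qed
      show "inv x \<in> Z" if "x \<in> Z" for x
      proof -
        have "inv x \<otimes> z = z \<otimes> inv x" if "z \<in> Q" for z
        proof -
          have "x \<in> carrier G" "z \<in> carrier G" "x \<otimes> z = z \<otimes> x"
            using \<open>x \<in> Z\<close> that QC ZQ Zcomm by blast+
          then have "z = x \<otimes> (z \<otimes> inv x)"
            by (metis inv_closed m_assoc r_inv r_one)
          then show ?thesis
            using inv_solve_left'[of "z \<otimes> inv x" x z] \<open>x \<in> carrier G\<close> \<open>z \<in> carrier G\<close> by simp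
        qed
        moreover have "inv x \<in> Q" using that ZQ Qs by (blast intro: subgroup.m_inv_closed)
        ultimately show ?thesis unfolding Z_def by blast
      qed
    qed (use one QC ZQ in auto)
    fix x h assume x: "x \<in> carrier G" and h: "h \<in> Z"
    \<comment> \<open>Conjugating back by \<open>x\<close> moves \<open>y\<close> to another element
      of \<open>Q\<close>, with which \<open>h\<close> commutes.\<close>
    have "x \<otimes> h \<otimes> inv x \<otimes> y = y \<otimes> (x \<otimes> h \<otimes> inv x)" if y: "y \<in> Q" for y
    proof -
      have "inv x \<otimes> y \<otimes> x \<in> Q" using normal.inv_op_closed1[OF Q(1)] x y by auto
      then have "h \<otimes> (inv x \<otimes> y \<otimes> x) = inv x \<otimes> y \<otimes> x \<otimes> h" using h Zcomm by blast
      then have "x \<otimes> (h \<otimes> (inv x \<otimes> y \<otimes> x)) \<otimes> inv x = x \<otimes> (inv x \<otimes> y \<otimes> x \<otimes> h) \<otimes> inv x" by simp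
      moreover have "h \<in> carrier G" "y \<in> carrier G" using h y QC ZQ by blast+
      moreover have "x \<otimes> (inv x \<otimes> z) = z" if "z \<in> carrier G" for z
        using x that by (simp flip: m_assoc)
      ultimately show ?thesis using x by (simp add: m_assoc)
    qed
    then show "x \<otimes> h \<otimes> inv x \<in> Z"
      using normal.inv_op_closed2[OF Q(1) x] ZQ[OF h] unfolding Z_def by blast
  qed
  let ?f = "\<lambda>g x. g \<otimes> x \<otimes> inv g"
  \<comment> \<open>An infinite set has \<open>card\<close> 0, which is not a power of
    \<open>q\<close>.\<close>
  have finQ: "finite Q" using Q(2) q by (metis card.infinite not_prime_0 power_not_zero)
  interpret act: group_action "G\<lparr>carrier := Q\<rparr>" Q "\<lambda>g. restrict (?f g) Q"
  proof (rule Q.group_action_restrict)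
  qed (use Qs QC in \<open>auto simp: subgroup.m_closed subgroup.m_inv_closed m_assoc inv_mult_group\<close>)
  have fixed: "?f g x = x \<longleftrightarrow> x \<otimes> g = g \<otimes> x" if "g \<in> Q" "x \<in> Q" for g x
    using that QC by (metis inv_solve_right' m_closed)
  then have "{x \<in> Q. \<forall>g \<in> carrier (G\<lparr>carrier := Q\<rparr>). restrict (?f g) Q x = x} = Z"
    by (auto simp: Z_def)
  then have "card Q mod q = card Z mod q"
    using act.card_fixed_points_cong[OF q _ finQ, of a] Q(2) by (simp add: order_def)
  moreover have "q dvd card Q" using Q(2,3) by simp
  ultimately have "q dvd card Z" by (metis dvd_eq_mod_eq_0)
  then show "Z \<noteq> {\<one>}" using q by auto
qed

end

section \<open>Soluble subgroups, homomorphic images and minimal supplements in finite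
  groups\<close>

text \<open>The derived series of \<open>S\<close> lies termwise inside that of \<open>L\<close>, so
  it reaches the trivial group as well.\<close>

lemma (in group) solvable_seq_subset:
  assumes "subgroup S G" "S \<subseteq> L" "solvable_seq G L"
  shows "solvable_seq G S"
proof -
  obtain n where n: "(derived G ^^ n) L = {\<one>}"
    using assms(3) solvable_imp_trivial_derived_seq by blast
  have "L \<subseteq> carrier G" using assms(3) solvable_imp_subgroup subgroup.subset by blast
  then have "(derived G ^^ n) S \<subseteq> {\<one>}"
    using mono_exp_of_derived[OF assms(2), of n] n by simp
  moreover have "\<one> \<in> (derived G ^^ n) S"
    using exp_of_derived_is_subgroup[OF assms(1)] subgroup.one_closed by blast
  ultimately show ?thesis using trivial_derived_seq_imp_solvable[OF assms(1), of n] by blast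
qed

lemma (in group_hom) subgroup_preimage:
  assumes "subgroup T H" shows "subgroup {x \<in> carrier G. h x \<in> T} G"
  by unfold_locales (use assms in \<open>auto intro: subgroup.m_closed subgroup.m_inv_closed subgroup.one_closed\<close>)

lemma (in group_hom) normal_preimage:
  assumes "T \<lhd> H" shows "{x \<in> carrier G. h x \<in> T} \<lhd> G"
  by (rule G.normal_invI)
    (use assms normal.inv_op_closed2[OF assms] subgroup_preimage[OF normal_imp_subgroup[OF assms]] in auto)

text \<open>The fibres of \<open>h\<close> are the cosets of its kernel. Finiteness of
  \<open>G\<close> is not assumed: later \<open>G\<close> is a pro-p group and only the index of the
  kernel is finite.\<close>

lemma (in group_hom) card_hom_image: "card (h ` carrier G) = card (rcosets (kernel G H h))"
proof -
  interpret K: normal "kernel G H h" G by (rule normal_kernel)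
  have "(\<lambda>X. the_elem (h ` X)) ` carrier (G Mod kernel G H h) = h ` carrier G"
  proof -
    have "h ` (kernel G H h #> x) = {h x}" if x: "x \<in> carrier G" for x
    proof -
      have "h y = h x" if y: "y \<in> kernel G H h #> x" for y
      proof -
        obtain k where k: "k \<in> carrier G" "h k = \<one>\<^bsub>H\<^esub>" "y = k \<otimes> x"
          using y unfolding r_coset_def kernel_def by blast
        show ?thesis unfolding k(3) using k(1,2) x by simp
      qed
      moreover have "x \<in> kernel G H h #> x" by (rule G.rcos_self[OF x K.subgroup_axioms])
      ultimately show ?thesis by blast
    qed
    then show ?thesis unfolding carrier_FactGroup image_image by (intro image_cong) simp_all
  qed
  then show ?thesis
    using card_image[OF FactGroup_inj_on] unfolding FactGroup_def by (metis partial_object.select_convs(1))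
qed

lemma (in group_hom) card_image_dvd: "card (h ` carrier G) dvd order G"
  using G.lagrange[OF subgroup_kernel] unfolding card_hom_image by (metis dvd_triv_left)

lemma (in group_hom) card_image_subgroup_dvd:
  assumes "subgroup A G" shows "card (h ` A) dvd card A"
proof -
  interpret A: group_hom "G\<lparr>carrier := A\<rparr>" H h
    using assms subgroup.subset[OF assms] G.subgroup_imp_group[OF assms]
    by (auto simp: group_hom_def group_hom_axioms_def hom_def subset_iff)
  show ?thesis using A.card_image_dvd by (simp add: order_def)
qed

lemma (in group_hom) minimal_supplement_solvable:
  assumes fin: "finite (carrier G)" and surj: "h ` carrier G = carrier H" and H: "solvable H"
    and p: "Factorial_Ring.prime p" and A: "subgroup A G" "card A = p ^ n"
    and minimal: "\<And>T. subgroup T G \<Longrightarrow> A \<subseteq> T \<Longrightarrow> h ` T = carrier H \<Longrightarrow> T = carrier G"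
  shows "solvable G"
proof -
  \<comment> \<open>Take \<open>L\<close> maximal among the solvable normal subgroups of \<open>G\<close> inside the kernel. If \<open>L\<close> is not
    the whole kernel, the Frattini argument and the minimality of \<open>G\<close> make some nontrivial
    \<open>q\<close>-subgroup of \<open>G / L\<close> normal, and the preimage of its centre is larger than \<open>L\<close>.\<close>
  let ?K = "kernel G H h"
  define LL where "LL = {L. L \<lhd> G \<and> L \<subseteq> ?K \<and> solvable_seq G L}"
  have "LL \<subseteq> Pow (carrier G)" by (auto simp: LL_def kernel_def)
  then have "finite LL" using fin by (meson finite_Pow_iff finite_subset)
  moreover have "{\<one>} \<in> LL"
    using G.one_is_normal solvable_seq.unity by (auto simp: LL_def kernel_def)
  ultimately obtain L where L: "L \<in> LL" and max: "\<And>M. M \<in> LL \<Longrightarrow> L \<subseteq> M \<Longrightarrow> M = L"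
    using finite_has_maximal[of LL] by (metis empty_iff)
  have LN: "L \<lhd> G" and LK: "L \<subseteq> ?K" and Lsolv: "solvable_seq G L" using L by (auto simp: LL_def)
  interpret L: normal L G by (rule LN)
  have "?K \<subseteq> L"
  proof (rule ccontr)
    assume "\<not> ?K \<subseteq> L"
    then obtain x0 where x0: "x0 \<in> ?K" "x0 \<notin> L" by blast
    define B where "B = G Mod L"
    define \<pi> where "\<pi> = (\<lambda>x. L #> x)"
    interpret B: group B unfolding B_def by (rule L.factorgroup_is_group)
    interpret \<pi>: group_hom G B \<pi>
      unfolding group_hom_def group_hom_axioms_def B_def \<pi>_def
      using L.factorgroup_is_group L.r_coset_hom_Mod G.is_group by blast
    have \<pi>_surj: "\<pi> ` carrier G = carrier B" by (simp add: B_def \<pi>_def carrier_FactGroup)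
    have \<pi>_one: "\<pi> x = \<one>\<^bsub>B\<^esub> \<longleftrightarrow> x \<in> L" if "x \<in> carrier G" for x
      using that G.coset_join1[OF _ that L.subgroup_axioms] G.coset_join2[OF that L.subgroup_axioms]
      by (auto simp: B_def \<pi>_def)
    have \<pi>_eq: "x \<otimes> inv y \<in> L" if "x \<in> carrier G" "y \<in> carrier G" "\<pi> x = \<pi> y" for x y
      using that by (subst \<pi>_one[symmetric]) auto
    have finB: "finite (carrier B)" using fin \<pi>_surj by (metis finite_imageI)
    have KG: "x \<in> carrier G" if "x \<in> ?K" for x using that by (simp add: kernel_def)
    have KB: "\<pi> ` ?K \<lhd> B"
      by (rule normal.surj_hom_normal_subgroup[OF normal_kernel \<pi>.group_hom_axioms \<pi>_surj])
    have "\<pi> x0 \<noteq> \<one>\<^bsub>B\<^esub>" using x0 KG \<pi>_one by blast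
    then have K_ne: "\<pi> ` ?K \<noteq> {\<one>\<^bsub>B\<^esub>}" using x0(1) by blast
    have AB: "subgroup (\<pi> ` A) B" using \<pi>.subgroup_img_is_subgroup[OF A(1)] .
    obtain m where m: "card (\<pi> ` A) = p ^ m"
      using \<pi>.card_image_subgroup_dvd[OF A(1)] A(2) p divides_primepow_nat by metis
    obtain q a Q where q: "Factorial_Ring.prime q" "subgroup Q B" "Q \<subseteq> \<pi> ` ?K" "card Q = q ^ a" "a \<noteq> 0"
      and QA: "\<And>x. x \<in> \<pi> ` A \<Longrightarrow> conj_set B x Q = Q"
      and frattini: "\<And>g. g \<in> carrier B \<Longrightarrow> \<exists>k\<in>\<pi> ` ?K. conj_set B (inv\<^bsub>B\<^esub> k \<otimes>\<^bsub>B\<^esub> g) Q = Q"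
      by (rule B.invariant_sylow_frattini[OF finB KB K_ne p AB m]) (rule that; assumption)
    have QB: "Q \<subseteq> carrier B" using q(2) subgroup.subset by blast
    \<comment> \<open>\<open>T\<close> is the preimage of the normaliser of \<open>Q\<close> in
      \<open>G / L\<close>. It contains \<open>A\<close>, and by the Frattini argument it maps onto
      \<open>H\<close>, so minimality makes it all of \<open>G\<close>.\<close>
    define T where "T = {x \<in> carrier G. \<pi> x \<in> {g \<in> carrier B. conj_set B g Q = Q}}"
    have "subgroup T G"
      unfolding T_def by (rule \<pi>.subgroup_preimage[OF B.subgroup_conj_stabilizer[OF QB]])
    moreover have "A \<subseteq> T"
      using QA subgroup.subset[OF A(1)] by (auto simp: T_def)
    moreover have "h ` T = carrier H"
    proof
      show "carrier H \<subseteq> h ` T"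
      proof
        fix c assume "c \<in> carrier H"
        then obtain g where g: "g \<in> carrier G" "c = h g" by (metis surj imageE)
        obtain k where k: "k \<in> ?K" "conj_set B (inv\<^bsub>B\<^esub> \<pi> k \<otimes>\<^bsub>B\<^esub> \<pi> g) Q = Q"
          using frattini[of "\<pi> g"] g by auto
        \<comment> \<open>As \<open>k\<close> lies in the kernel of \<open>h\<close>, replacing
          \<open>g\<close> by \<open>inv k \<otimes> g\<close> keeps the image
          \<open>c\<close>.\<close>
        have "inv k \<otimes> g \<in> T" using k g KG by (auto simp: T_def)
        moreover have "h (inv k \<otimes> g) = c" using k(1) g by (simp add: kernel_def)
        ultimately show "c \<in> h ` T" by blast
      qed
    qed (auto simp: T_def)
    ultimately have T: "T = carrier G" by (rule minimal)
    have "conj_set B g Q = Q" if g: "g \<in> carrier B" for g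
    proof -
      obtain x where x: "x \<in> carrier G" "\<pi> x = g" by (metis g \<pi>_surj imageE)
      then have "x \<in> T" using T by blast
      then have "conj_set B (\<pi> x) Q = Q" unfolding T_def by blast
      then show ?thesis using x(2) by simp
    qed
    then have QN: "Q \<lhd> B"
      by (intro B.normal_invI[OF q(2)]) (auto simp: conj_set_def)
    define Z where "Z = {x \<in> Q. \<forall>y\<in>Q. x \<otimes>\<^bsub>B\<^esub> y = y \<otimes>\<^bsub>B\<^esub> x}"
    have Z: "Z \<lhd> B" "Z \<noteq> {\<one>\<^bsub>B\<^esub>}"
      using B.normal_p_subgroup_center[OF q(1) QN q(4,5)] by (simp_all add: Z_def)
    have Z_comm: "x \<otimes>\<^bsub>B\<^esub> y = y \<otimes>\<^bsub>B\<^esub> x" if "x \<in> Z" "y \<in> Z" for x y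
      using that unfolding Z_def by blast
    define M where "M = {x \<in> carrier G. \<pi> x \<in> Z}"
    have MN: "M \<lhd> G" unfolding M_def by (rule \<pi>.normal_preimage[OF Z(1)])
    then have M: "subgroup M G" by (rule normal_imp_subgroup)
    have MG: "x \<in> carrier G" if "x \<in> M" for x using that by (simp add: M_def)
    have LM: "L \<subseteq> M"
    proof
      fix x assume "x \<in> L"
      then have "x \<in> carrier G" "\<pi> x = \<one>\<^bsub>B\<^esub>" using \<pi>_one by auto
      then show "x \<in> M" using subgroup.one_closed[OF normal_imp_subgroup[OF Z(1)]] by (simp add: M_def)
    qed
    have "M \<subseteq> ?K"
    proof
      fix x assume x: "x \<in> M"
      then have "\<pi> x \<in> \<pi> ` ?K" using q(3) unfolding M_def Z_def by blast
      then obtain k where k: "k \<in> ?K" "\<pi> x = \<pi> k" by blast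
      then have "x \<otimes> inv k \<in> ?K" using \<pi>_eq x KG MG LK by blast
      then have "h x = \<one>\<^bsub>H\<^esub>" using k(1) MG[OF x] by (simp add: kernel_def)
      then show "x \<in> ?K" using MG[OF x] by (simp add: kernel_def)
    qed
    \<comment> \<open>\<open>M / L\<close> is the abelian group \<open>Z\<close>, so commutators of
      \<open>M\<close> fall into the soluble group \<open>L\<close>. Hence \<open>M\<close> belongs
      to \<open>LL\<close>, and maximality gives \<open>M = L\<close>, against \<open>Z\<close>
      being nontrivial.\<close>
    moreover have "derived G M \<subseteq> L"
      unfolding derived_def
    proof (rule G.generate_subgroup_incl[OF _ L.subgroup_axioms], clarify)
      fix x y assume xy: "x \<in> M" "y \<in> M"
      then have "\<pi> x \<otimes>\<^bsub>B\<^esub> \<pi> y = \<pi> y \<otimes>\<^bsub>B\<^esub> \<pi> x" using Z_comm unfolding M_def by blast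
      then have "\<pi> (x \<otimes> y) = \<pi> (y \<otimes> x)" using MG xy by simp
      then have "(x \<otimes> y) \<otimes> inv (y \<otimes> x) \<in> L" using \<pi>_eq MG xy by blast
      then show "x \<otimes> y \<otimes> inv x \<otimes> inv y \<in> L"
        using MG xy by (simp add: G.inv_mult_group G.m_assoc)
    qed
    then have "solvable_seq G (derived G M)"
      using G.solvable_seq_subset[OF G.derived_is_subgroup[OF subgroup.subset[OF M]] _ Lsolv] by blast
    then have "solvable_seq G M" using G.augment_solvable_seq[OF M] by blast
    ultimately have "M \<in> LL" using MN by (simp add: LL_def)
    then have "M = L" using max LM by blast
    have "Z \<subseteq> {\<one>\<^bsub>B\<^esub>}"
    proof
      fix z assume z: "z \<in> Z"
      then have "z \<in> carrier B" using q(2) subgroup.subset unfolding Z_def by blast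
      then obtain x where x: "x \<in> carrier G" "z = \<pi> x" by (metis \<pi>_surj imageE)
      then have "x \<in> L" using z \<open>M = L\<close> by (auto simp: M_def)
      then show "z \<in> {\<one>\<^bsub>B\<^esub>}" using \<pi>_one x by auto
    qed
    then show False using Z subgroup.one_closed[OF normal_imp_subgroup[OF Z(1)]] by blast
  qed
  \<comment> \<open>\<open>solvable_seq_condition\<close> treats an extension given by two maps;
    here the first is the identity of \<open>G\<close>, applied to \<open>L\<close>, and the second
    is \<open>h\<close>.\<close>
  moreover have "group_hom G G (\<lambda>x. x)"
    by (simp add: group_hom_def group_hom_axioms_def hom_def G.is_group)
  ultimately show ?thesis
    unfolding solvable_def
    using solvable_seq_condition[OF _ group_hom_axioms, of G "\<lambda>x. x" L "carrier G"] Lsolv H surj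
      G.subgroup_self L.subset by (auto simp: solvable_def)
qed

section \<open>Profinite groups\<close>

lemma sub_top_group_simps [simp]:
  "carrier (sub_top_group G R) = R"
  "x \<otimes>\<^bsub>sub_top_group G R\<^esub> y = x \<otimes>\<^bsub>G\<^esub> y"
  "\<one>\<^bsub>sub_top_group G R\<^esub> = \<one>\<^bsub>G\<^esub>"
  "topo (sub_top_group G R) = subtopology (topo G) R"
  by (simp_all add: sub_top_group_def)

lemma group_sub_top_group:
  assumes "group G" "subgroup R G" shows "group (sub_top_group G R)"
proof -
  interpret G: group G by fact
  interpret R: subgroup R G by fact
  show ?thesis
  proof (rule groupI)
    show "\<exists>y\<in>carrier (sub_top_group G R). y \<otimes>\<^bsub>sub_top_group G R\<^esub> x = \<one>\<^bsub>sub_top_group G R\<^esub>"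
      if "x \<in> carrier (sub_top_group G R)" for x
      using that by (intro bexI[of _ "inv\<^bsub>G\<^esub> x"]) auto
  qed (auto simp: G.m_assoc)
qed

lemma inv_sub_top_group:
  assumes "group G" "subgroup R G" "x \<in> R"
  shows "inv\<^bsub>sub_top_group G R\<^esub> x = inv\<^bsub>G\<^esub> x"
proof -
  \<comment> \<open>Inverses depend only on carrier, product and unit, so the changed topology can
    be ignored.\<close>
  have "inv\<^bsub>sub_top_group G R\<^esub> x = inv\<^bsub>G\<lparr>carrier := R\<rparr>\<^esub> x"
    by (simp add: m_inv_def)
  then show ?thesis using group.m_inv_consistent assms by metis
qed

lemma subgroup_sub_top_group_iff:
  assumes "group G" "subgroup R G"
  shows "subgroup T (sub_top_group G R) \<longleftrightarrow> subgroup T G \<and> T \<subseteq> R"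
proof
  assume T: "subgroup T (sub_top_group G R)"
  then have "T \<subseteq> R" using subgroup.subset by fastforce
  moreover have "subgroup T G"
  proof
    show "T \<subseteq> carrier G" using \<open>T \<subseteq> R\<close> subgroup.subset[OF assms(2)] by blast
    show "x \<otimes>\<^bsub>G\<^esub> y \<in> T" if "x \<in> T" "y \<in> T" for x y
      using subgroup.m_closed[OF T that] by simp
    show "\<one>\<^bsub>G\<^esub> \<in> T" using subgroup.one_closed[OF T] by simp
    show "inv\<^bsub>G\<^esub> x \<in> T" if "x \<in> T" for x
      using subgroup.m_inv_closed[OF T that] inv_sub_top_group[OF assms] that \<open>T \<subseteq> R\<close> by auto
  qed
  ultimately show "subgroup T G \<and> T \<subseteq> R" by blast
next
  assume T: "subgroup T G \<and> T \<subseteq> R"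
  then have T': "subgroup T G" by blast
  show "subgroup T (sub_top_group G R)"
  proof
    show "inv\<^bsub>sub_top_group G R\<^esub> x \<in> T" if "x \<in> T" for x
      using subgroup.m_inv_closed[OF T' that] inv_sub_top_group[OF assms] that T by auto
  qed (use T subgroup.m_closed[OF T'] subgroup.one_closed[OF T'] in auto)
qed

section \<open>Soluble quotients and cosets of normal subgroups\<close>

text \<open>Homomorphisms carry the derived series of \<open>G\<close> to that of the image. Once it
  dies in \<open>H\<close>, the corresponding term in \<open>G\<close> lies in the kernel of
  \<open>h\<close>, hence in that of \<open>g\<close>. As \<open>h\<close> may map onto a proper
  subgroup, this serves for both subgroups and quotients of soluble groups.\<close>

lemma (in group_hom) solvable_of_kernel_subset:
  assumes g: "group_hom G Q g" and surj: "g ` carrier G = carrier Q"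
    and ker: "kernel G H h \<subseteq> kernel G Q g" and H: "solvable H"
  shows "solvable Q"
proof -
  interpret g: group_hom G Q g by (rule g)
  obtain n where n: "(derived H ^^ n) (carrier H) = {\<one>\<^bsub>H\<^esub>}"
    using H.solvable_iff_trivial_derived_seq H by blast
  let ?D = "(derived G ^^ n) (carrier G)"
  have D: "?D \<subseteq> carrier G" by (rule G.exp_of_derived_in_carrier) simp
  have "h ` ?D = (derived H ^^ n) (h ` carrier G)"
    using exp_of_derived_img[of "carrier G" n] by simp
  also have "\<dots> \<subseteq> (derived H ^^ n) (carrier H)"
    by (rule H.mono_exp_of_derived) auto
  finally have "?D \<subseteq> kernel G Q g" using n D ker by (auto simp: kernel_def)
  then have "g ` ?D \<subseteq> {\<one>\<^bsub>Q\<^esub>}" by (auto simp: kernel_def)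
  moreover have "g ` ?D = (derived Q ^^ n) (carrier Q)"
    using g.exp_of_derived_img[of "carrier G" n] surj by simp
  moreover have "\<one>\<^bsub>Q\<^esub> \<in> (derived Q ^^ n) (carrier Q)"
    using subgroup.one_closed[OF g.H.exp_of_derived_is_subgroup[OF g.H.subgroup_self]] .
  ultimately have "(derived Q ^^ n) (carrier Q) = {\<one>\<^bsub>Q\<^esub>}" by blast
  then show ?thesis using g.H.solvable_iff_trivial_derived_seq by blast
qed

lemma (in normal) FactGroup_group_hom: "group_hom G (G Mod H) (\<lambda>x. H #> x)"
  using factorgroup_is_group r_coset_hom_Mod is_group by (simp add: group_hom_def group_hom_axioms_def)

lemma (in normal) kernel_FactGroup_hom: "kernel G (G Mod H) (\<lambda>x. H #> x) = H"
proof -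
  have "H #> x = H \<longleftrightarrow> x \<in> H" if "x \<in> carrier G" for x
    using coset_join1[OF _ that subgroup_axioms] coset_join2[OF that subgroup_axioms] by auto
  then show ?thesis using subset by (auto simp: kernel_def)
qed

lemma (in normal) r_coset_eq_iff:
  assumes "x \<in> carrier G" "y \<in> carrier G"
  shows "H #> x = H #> y \<longleftrightarrow> x \<otimes> inv y \<in> H"
proof -
  have "H #> x = H #> y \<longleftrightarrow> x \<in> H #> y"
    using assms repr_independence rcos_self subgroup_axioms by metis
  then show ?thesis using rcos_module[OF is_group assms(2,1)] by simp
qed

section \<open>Topological groups and their open subgroups\<close>

text \<open>The tube lemma, in a form showing that an open condition required for all points of a
  compact set is again open.\<close>

lemma openin_forall_compactin:
  assumes C: "compactin X C" and W: "openin (prod_topology X Y) W"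
  shows "openin Y {y \<in> topspace Y. C \<times> {y} \<subseteq> W}"
proof (subst openin_subopen, clarify)
  fix y assume y: "y \<in> topspace Y" "C \<times> {y} \<subseteq> W"
  then obtain U V where UV: "openin X U" "openin Y V" "C \<subseteq> U" "y \<in> V" "U \<times> V \<subseteq> W"
    using tube_lemma_left[OF W C y] by metis
  have "V \<subseteq> {y \<in> topspace Y. C \<times> {y} \<subseteq> W}"
  proof
    fix v assume v: "v \<in> V"
    then have "C \<times> {v} \<subseteq> U \<times> V" using UV(3) by blast
    then show "v \<in> {y \<in> topspace Y. C \<times> {y} \<subseteq> W}"
      using UV(5) v openin_subset[OF UV(2)] by blast
  qed
  then show "\<exists>T. openin Y T \<and> y \<in> T \<and> T \<subseteq> {y \<in> topspace Y. C \<times> {y} \<subseteq> W}"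
    using UV by blast
qed

context topological_group
begin

lemma continuous_map_mult:
  assumes "continuous_map X (topo G) f" "continuous_map X (topo G) g"
  shows "continuous_map X (topo G) (\<lambda>x. f x \<otimes> g x)"
  using continuous_map_compose[OF continuous_map_pairedI[OF assms] continuous_mult]
  by (simp add: o_def)

lemma continuous_map_inv:
  assumes "continuous_map X (topo G) f"
  shows "continuous_map X (topo G) (\<lambda>x. inv f x)"
  using continuous_map_compose[OF assms continuous_inv] by (simp add: o_def)

lemma topological_group_sub:
  assumes R: "subgroup R G" shows "topological_group (sub_top_group G R)"
proof -
  interpret R: group "sub_top_group G R" using group_sub_top_group[OF is_group R] .
  have sub: "R \<subseteq> carrier G" using R subgroup.subset by blast
  show ?thesis
  proof
    show "topspace (topo (sub_top_group G R)) = carrier (sub_top_group G R)"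
      using sub topspace_topo by auto
    have "continuous_map (subtopology (prod_topology (topo G) (topo G)) (R \<times> R)) (subtopology (topo G) R) (\<lambda>(x, y). x \<otimes> y)"
      using continuous_map_from_subtopology[OF continuous_mult] subgroup.m_closed[OF R]
      by (auto simp: continuous_map_in_subtopology)
    then show "continuous_map (prod_topology (topo (sub_top_group G R)) (topo (sub_top_group G R)))
       (topo (sub_top_group G R)) (\<lambda>(x, y). x \<otimes>\<^bsub>sub_top_group G R\<^esub> y)"
      by (simp add: subtopology_Times)
    have "continuous_map (subtopology (topo G) R) (subtopology (topo G) R) (\<lambda>x. inv x)"
      using continuous_map_from_subtopology[OF continuous_inv] subgroup.m_inv_closed[OF R]
      by (auto simp: continuous_map_in_subtopology)
    then show "continuous_map (topo (sub_top_group G R)) (topo (sub_top_group G R)) (\<lambda>x. inv\<^bsub>sub_top_group G R\<^esub> x)"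
      unfolding sub_top_group_simps
      by (rule continuous_map_eq) (use inv_sub_top_group[OF is_group R] in auto)
  qed
qed

text \<open>The coset is the preimage of \<open>N\<close> under right translation by
  \<open>inv x\<close>.\<close>

lemma openin_r_coset:
  assumes N: "openin (topo G) N" and x: "x \<in> carrier G"
  shows "openin (topo G) (N #> x)"
proof -
  have NG: "N \<subseteq> carrier G" using openin_subset[OF N] topspace_topo by simp
  have "N #> x = {y \<in> topspace (topo G). y \<otimes> inv x \<in> N}"
  proof (intro equalityI subsetI)
    fix y assume "y \<in> N #> x"
    then obtain n where n: "n \<in> N" "y = n \<otimes> x" by (auto simp: r_coset_def)
    then show "y \<in> {y \<in> topspace (topo G). y \<otimes> inv x \<in> N}"
      using NG x by (auto simp: topspace_topo m_assoc subset_iff)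
  next
    fix y assume "y \<in> {y \<in> topspace (topo G). y \<otimes> inv x \<in> N}"
    then have y: "y \<in> carrier G" "y \<otimes> inv x \<in> N" by (auto simp: topspace_topo)
    moreover have "y = y \<otimes> inv x \<otimes> x" using x y by (simp add: m_assoc)
    ultimately show "y \<in> N #> x" unfolding r_coset_def by blast
  qed
  moreover have "continuous_map (topo G) (topo G) (\<lambda>y. y \<otimes> inv x)"
    using x topspace_topo by (intro continuous_map_mult) auto
  ultimately show ?thesis using openin_continuous_map_preimage N by metis
qed

text \<open>\<open>M\<close> is a union of open cosets of \<open>N\<close>.\<close>

lemma openin_supergroup:
  assumes N: "openin (topo G) N" "subgroup N G" and M: "subgroup M G" "N \<subseteq> M"
  shows "openin (topo G) M"
proof -
  have MG: "M \<subseteq> carrier G" using M subgroup.subset by blast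
  have "M = (\<Union>x\<in>M. N #> x)"
  proof
    show "M \<subseteq> (\<Union>x\<in>M. N #> x)" using rcos_self[OF _ N(2)] MG by blast
    show "(\<Union>x\<in>M. N #> x) \<subseteq> M"
      using subgroup.m_closed[OF M(1)] M(2) by (auto simp: r_coset_def)
  qed
  moreover have "openin (topo G) (\<Union>x\<in>M. N #> x)"
    using openin_r_coset[OF N(1)] MG by blast
  ultimately show ?thesis by simp
qed

text \<open>The complement is a union of open cosets.\<close>

lemma closedin_open_subgroup:
  assumes N: "openin (topo G) N" "subgroup N G" shows "closedin (topo G) N"
proof -
  interpret N: subgroup N G by (rule N(2))
  have "carrier G - N = (\<Union>x\<in>carrier G - N. N #> x)"
  proof
    show "carrier G - N \<subseteq> (\<Union>x\<in>carrier G - N. N #> x)" using rcos_self[OF _ N(2)] by blast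
    show "(\<Union>x\<in>carrier G - N. N #> x) \<subseteq> carrier G - N"
    proof clarify
      fix x y assume x: "x \<in> carrier G" "x \<notin> N" and "y \<in> N #> x"
      then obtain n where n: "n \<in> N" "y = n \<otimes> x" by (auto simp: r_coset_def)
      then have "x = inv n \<otimes> y" using x by (simp flip: m_assoc)
      then have "y \<notin> N" using n(1) x(2) by auto
      then show "y \<in> carrier G - N" using n x by simp
    qed
  qed
  moreover have "openin (topo G) (\<Union>x\<in>carrier G - N. N #> x)"
    using openin_r_coset[OF N(1)] by blast
  ultimately show ?thesis by (simp add: closedin_def topspace_topo N.subset)
qed

end

lemma closed_subgroup_sub_top_group:
  assumes "group G" "closed_subgroup R G" "closed_subgroup T (sub_top_group G R)"
  shows "closed_subgroup T G" "T \<subseteq> R"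
  using assms subgroup_sub_top_group_iff closedin_closed_subtopology
  unfolding closed_subgroup_def by (metis sub_top_group_simps(4))+

section \<open>Compactness: finite index and open normal subgroups\<close>

context profinite_group
begin

lemma profinite_sub:
  assumes "closed_subgroup R G" shows "profinite_group (sub_top_group G R)"
proof -
  have R: "subgroup R G" "closedin (topo G) R" using assms by (auto simp: closed_subgroup_def)
  interpret R: topological_group "sub_top_group G R" using topological_group_sub[OF R(1)] .
  show ?thesis
  proof
    show "compact_space (topo (sub_top_group G R))"
      using closedin_compact_space[OF compact R(2)] by (simp add: compact_space_subtopology)
    show "Hausdorff_space (topo (sub_top_group G R))"
      using Hausdorff by (simp add: Hausdorff_space_subtopology)
    show "\<exists>a. S \<subseteq> {a}" if "connectedin (topo (sub_top_group G R)) S" for S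
      using that totally_disconnected by (simp add: connectedin_subtopology)
  qed
qed

text \<open>The cosets are a disjoint open cover of a compact space, so a finite subcover must
  contain every one of them.\<close>

lemma finite_rcosets_open:
  assumes N: "openin (topo G) N" "subgroup N G" shows "finite (rcosets N)"
proof -
  have "\<forall>U\<in>rcosets N. openin (topo G) U"
    using openin_r_coset[OF N(1)] by (auto simp: RCOSETS_def)
  moreover have "topspace (topo G) \<subseteq> \<Union>(rcosets N)"
    using rcosets_part_G[OF N(2)] topspace_topo by simp
  ultimately obtain \<F> where F: "finite \<F>" "\<F> \<subseteq> rcosets N" "topspace (topo G) \<subseteq> \<Union>\<F>"
    using compact unfolding compact_space_alt by meson
  have "rcosets N \<subseteq> \<F>"
  proof
    fix C assume C: "C \<in> rcosets N"
    then obtain x where x: "x \<in> C" "x \<in> carrier G"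
      using rcos_self[OF _ N(2)] by (auto simp: RCOSETS_def)
    then obtain D where D: "D \<in> \<F>" "x \<in> D" using F(3) topspace_topo by blast
    then have "C = D" using C F(2) x rcos_disjoint[OF N(2)] unfolding pairwise_def disjnt_def by blast
    then show "C \<in> \<F>" using D by simp
  qed
  then show ?thesis using F(1) finite_subset by blast
qed

text \<open>Total disconnectedness gives a clopen set \<open>W\<close> inside \<open>U\<close>
  around the unit; its stabiliser under translation is an open subgroup, and the normal core of that
  is still open by compactness.\<close>

lemma open_normal_subgroup_basis:
  assumes U: "openin (topo G) U" "\<one> \<in> U"
  obtains N where "N \<lhd> G" "openin (topo G) N" "N \<subseteq> U"
proof -
  let ?X = "topo G"
  have one: "\<one> \<in> topspace ?X" using topspace_topo by simp
  \<comment> \<open>In a compact Hausdorff space quasi-components are components, here single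
    points, so a clopen set separates the unit from the complement of \<open>U\<close>.\<close>
  have "quasi_component_of_set ?X \<one> = connected_component_of_set ?X \<one>"
    using quasi_eq_connected_component_of[of ?X \<one>] compact Hausdorff by auto
  also obtain a where "connected_component_of_set ?X \<one> \<subseteq> {a}"
    using totally_disconnected[OF connectedin_connected_component_of] by blast
  then have "connected_component_of_set ?X \<one> = {\<one>}"
    using connected_component_of_refl[of ?X \<one>] one by blast
  finally have "{\<one>} \<in> quasi_components_of ?X"
    using quasi_component_in_quasi_components_of[of ?X \<one>] one by simp
  moreover have "compactin ?X (topspace ?X - U)"
    using U closedin_compact_space[OF compact] by blast
  ultimately have "separated_between ?X {\<one>} (topspace ?X - U)"
    using separated_between_quasi_component_compact U(2) by (auto simp: disjnt_def)
  then obtain W where W: "closedin ?X W" "openin ?X W" "\<one> \<in> W" "topspace ?X - U \<subseteq> topspace ?X - W"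
    unfolding separated_between by auto
  then have WU: "W \<subseteq> U" using openin_subset by blast
  have WG: "W \<subseteq> carrier G" using openin_subset[OF W(2)] topspace_topo by simp
  have Wc: "compactin ?X W" using W(1) closedin_compact_space[OF compact] by blast
  have mult: "continuous_map (prod_topology ?X ?X) ?X (\<lambda>z. fst z \<otimes> snd z)"
    by (intro continuous_map_mult continuous_map_fst continuous_map_snd)
  have multinv: "continuous_map (prod_topology ?X ?X) ?X (\<lambda>z. fst z \<otimes> inv snd z)"
    by (intro continuous_map_mult continuous_map_inv continuous_map_fst continuous_map_snd)
  \<comment> \<open>\<open>H\<close> is the stabiliser of \<open>W\<close> under right translation;
    the condition on \<open>inv x\<close> builds in closure under inverses. It is open because
    \<open>W\<close> is compact, and lies in \<open>W\<close> because the unit does.\<close>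
  define H where "H = {x \<in> carrier G. \<forall>w\<in>W. w \<otimes> x \<in> W \<and> w \<otimes> inv x \<in> W}"
  have HG: "x \<in> carrier G" if "x \<in> H" for x using that by (simp add: H_def)
  have H1: "w \<otimes> x \<in> W" if "x \<in> H" "w \<in> W" for x w using that by (simp add: H_def)
  have H2: "w \<otimes> inv x \<in> W" if "x \<in> H" "w \<in> W" for x w using that by (simp add: H_def)
  let ?P = "{z \<in> topspace (prod_topology ?X ?X). fst z \<otimes> snd z \<in> W} \<inter> {z \<in> topspace (prod_topology ?X ?X). fst z \<otimes> inv snd z \<in> W}"
  have "H = {y \<in> topspace ?X. W \<times> {y} \<subseteq> ?P}"
    using WG topspace_topo by (auto simp: H_def)
  moreover have P: "openin (prod_topology ?X ?X) ?P"
    by (intro openin_Int openin_continuous_map_preimage[OF mult W(2)] openin_continuous_map_preimage[OF multinv W(2)])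
  ultimately have Hopen: "openin ?X H"
    using openin_forall_compactin[OF Wc P] by simp
  have Hsub: "subgroup H G"
  proof
    show "x \<otimes> y \<in> H" if xy: "x \<in> H" "y \<in> H" for x y
    proof -
      have "w \<otimes> (x \<otimes> y) \<in> W" "w \<otimes> inv (x \<otimes> y) \<in> W" if w: "w \<in> W" for w
      proof -
        have wG: "w \<in> carrier G" using w WG by auto
        have "w \<otimes> x \<otimes> y \<in> W" using H1 xy w by blast
        then show "w \<otimes> (x \<otimes> y) \<in> W" using HG xy wG by (simp add: m_assoc)
        have "w \<otimes> inv y \<otimes> inv x \<in> W" using H2 xy w by blast
        then show "w \<otimes> inv (x \<otimes> y) \<in> W" using HG xy wG by (simp add: m_assoc inv_mult_group)
      qed
      then show ?thesis using HG xy by (simp add: H_def)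
    qed
  qed (use WG in \<open>auto simp: H_def\<close>)
  have HW: "H \<subseteq> W" using H1[OF _ W(3)] HG by fastforce
  \<comment> \<open>The normal core of \<open>H\<close>: a condition over all conjugators
    \<open>g\<close>, open because the whole group is compact.\<close>
  define N where "N = {x \<in> carrier G. \<forall>g\<in>carrier G. g \<otimes> x \<otimes> inv g \<in> H}"
  have NG: "x \<in> carrier G" if "x \<in> N" for x using that by (simp add: N_def)
  have N1: "g \<otimes> x \<otimes> inv g \<in> H" if "x \<in> N" "g \<in> carrier G" for x g using that by (simp add: N_def)
  have conj: "continuous_map (prod_topology ?X ?X) ?X (\<lambda>z. fst z \<otimes> snd z \<otimes> inv fst z)"
    by (intro continuous_map_mult continuous_map_inv continuous_map_fst continuous_map_snd)
  let ?R = "{z \<in> topspace (prod_topology ?X ?X). fst z \<otimes> snd z \<otimes> inv fst z \<in> H}"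
  have "N = {y \<in> topspace ?X. topspace ?X \<times> {y} \<subseteq> ?R}"
    using topspace_topo by (auto simp: N_def)
  then have Nopen: "openin ?X N"
    using openin_forall_compactin[OF _ openin_continuous_map_preimage[OF conj Hopen], of "topspace ?X"]
      compact by (simp add: compact_space_def)
  have Nsub: "subgroup N G"
  proof
    show "x \<otimes> y \<in> N" if xy: "x \<in> N" "y \<in> N" for x y
    proof -
      have "g \<otimes> (x \<otimes> y) \<otimes> inv g \<in> H" if g: "g \<in> carrier G" for g
      proof -
        have "(g \<otimes> x \<otimes> inv g) \<otimes> (g \<otimes> y \<otimes> inv g) \<in> H"
          using N1 xy g subgroup.m_closed[OF Hsub] by blast
        moreover have "inv g \<otimes> (g \<otimes> (y \<otimes> inv g)) = y \<otimes> inv g"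
          using g NG xy by (simp flip: m_assoc)
        ultimately show ?thesis using g NG xy by (simp add: m_assoc)
      qed
      moreover have "x \<otimes> y \<in> carrier G" using NG xy by blast
      ultimately show ?thesis unfolding N_def by blast
    qed
    show "inv x \<in> N" if x: "x \<in> N" for x
    proof -
      have "g \<otimes> inv x \<otimes> inv g \<in> H" if g: "g \<in> carrier G" for g
        using subgroup.m_inv_closed[OF Hsub N1[OF x g]] g NG[OF x] by (simp add: inv_mult_group m_assoc)
      moreover have "inv x \<in> carrier G" using NG x by blast
      ultimately show ?thesis unfolding N_def by blast
    qed
  qed (use subgroup.one_closed[OF Hsub] in \<open>auto simp: N_def\<close>)
  have "N \<lhd> G"
  proof (rule normal_invI[OF Nsub])
    fix x h assume x: "x \<in> carrier G" and h: "h \<in> N"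
    have "g \<otimes> (x \<otimes> h \<otimes> inv x) \<otimes> inv g \<in> H" if g: "g \<in> carrier G" for g
      using N1[OF h, of "g \<otimes> x"] g x NG[OF h] by (simp add: inv_mult_group m_assoc)
    moreover have "x \<otimes> h \<otimes> inv x \<in> carrier G" using x NG[OF h] by blast
    ultimately show "x \<otimes> h \<otimes> inv x \<in> N" unfolding N_def by blast
  qed
  moreover have "N \<subseteq> H" using N1[of _ \<one>] NG by fastforce
  ultimately show ?thesis using that[of N] Nopen HW WU by blast
qed

end

section \<open>Minimal supplements and the retract\<close>

lemma prosoluble_groupD: "prosoluble_group G \<Longrightarrow> profinite_group G"
  by (simp add: prosoluble_group_def)

lemma profinite_groupD:
  assumes "profinite_group G" shows "group G" "topological_group G"
  using assms by (auto simp: profinite_group_def topological_group_def)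

lemma pro_p_groupD: "pro_p_group p G \<Longrightarrow> profinite_group G"
  by (simp add: pro_p_group_def)

text \<open>Finiteness of the quotients by open normal subgroups is automatic by
  compactness.\<close>

lemma (in profinite_group) prosolubleI:
  assumes "\<And>N. N \<lhd> G \<Longrightarrow> openin (topo G) N \<Longrightarrow> solvable (G Mod N)"
  shows "prosoluble_group G"
  using assms finite_rcosets_open normal_imp_subgroup profinite_group_axioms
  unfolding prosoluble_group_def by (auto simp: FactGroup_def)

lemma cont_hom_group_hom:
  assumes "profinite_group G" "profinite_group H" "h \<in> cont_hom G H"
  shows "group_hom G H h"
  using assms profinite_groupD by (auto simp: cont_hom_def group_hom_def group_hom_axioms_def)

lemma cont_hom_compose:
  assumes "group G" "f \<in> cont_hom G H" "g \<in> cont_hom H K" shows "g \<circ> f \<in> cont_hom G K"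
  using assms hom_compose continuous_map_compose unfolding cont_hom_def by blast

lemma cont_hom_into_sub:
  assumes "f \<in> cont_hom G H" "f ` carrier G \<subseteq> R" "topological_group G"
  shows "f \<in> cont_hom G (sub_top_group H R)"
  using assms topological_group.topspace_topo[OF assms(3)]
  by (auto simp: cont_hom_def hom_def continuous_map_in_subtopology)

lemma cont_hom_from_sub:
  assumes "f \<in> cont_hom G H" "subgroup R G"
  shows "f \<in> cont_hom (sub_top_group G R) H"
  using assms subgroup.subset[OF assms(2)]
  by (auto simp: cont_hom_def hom_def continuous_map_from_subtopology subset_iff)

lemma cont_hom_sub_into:
  assumes "f \<in> cont_hom G (sub_top_group H R)" "R \<subseteq> carrier H"
  shows "f \<in> cont_hom G H"
  using assms by (auto simp: cont_hom_def hom_def continuous_map_in_subtopology)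

text \<open>A continuous image of a compact set is compact, hence closed in a Hausdorff
  space.\<close>

lemma cont_hom_image_closed_subgroup:
  assumes G: "profinite_group G" and H: "profinite_group H" and h: "h \<in> cont_hom G H"
    and R: "closed_subgroup R G"
  shows "closed_subgroup (h ` R) H"
proof -
  interpret G: profinite_group G by (rule G)
  interpret H: profinite_group H by (rule H)
  interpret h: group_hom G H h by (rule cont_hom_group_hom[OF G H h])
  have "compactin (topo G) R"
    using R closedin_compact_space[OF G.compact] by (auto simp: closed_subgroup_def)
  then have "compactin (topo H) (h ` R)"
    using image_compactin h unfolding cont_hom_def by blast
  then show ?thesis
    using compactin_imp_closedin[OF H.Hausdorff] h.subgroup_img_is_subgroup R
    by (auto simp: closed_subgroup_def)
qed

lemma (in topological_group) closed_subgroup_carrier: "closed_subgroup (carrier G) G"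
  using subgroup_self closedin_topspace topspace_topo unfolding closed_subgroup_def by metis

lemma cont_hom_preimage_open_normal:
  assumes G: "profinite_group G" and H: "profinite_group H" and h: "h \<in> cont_hom G H"
    and N: "N \<lhd> H" "openin (topo H) N"
  shows "{x \<in> carrier G. h x \<in> N} \<lhd> G" "openin (topo G) {x \<in> carrier G. h x \<in> N}"
proof -
  interpret G: profinite_group G by (rule G)
  interpret h: group_hom G H h by (rule cont_hom_group_hom[OF G H h])
  show "{x \<in> carrier G. h x \<in> N} \<lhd> G" by (rule h.normal_preimage[OF N(1)])
  show "openin (topo G) {x \<in> carrier G. h x \<in> N}"
    using h openin_continuous_map_preimage[OF _ N(2)] G.topspace_topo unfolding cont_hom_def
    by (metis (no_types, lifting) Collect_cong mem_Collect_eq)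
qed

text \<open>For an open normal \<open>N\<close> in \<open>H\<close> with preimage \<open>M\<close>,
  the map from \<open>G\<close> onto \<open>H / N\<close> kills \<open>M\<close>, so
  \<open>H / N\<close> inherits solubility from \<open>G / M\<close>.\<close>

lemma prosoluble_continuous_image:
  assumes G: "prosoluble_group G" and H: "profinite_group H" and h: "h \<in> cont_hom G H"
    and surj: "h ` carrier G = carrier H"
  shows "prosoluble_group H"
proof -
  interpret H: profinite_group H by (rule H)
  have Gf: "profinite_group G" using G prosoluble_groupD by blast
  interpret h: group_hom G H h by (rule cont_hom_group_hom[OF Gf H h])
  show ?thesis
  proof (rule H.prosolubleI)
    fix N assume N: "N \<lhd> H" "openin (topo H) N"
    interpret N: normal N H by (rule N(1))
    interpret f: group_hom H "H Mod N" "\<lambda>x. N #>\<^bsub>H\<^esub> x" by (rule N.FactGroup_group_hom)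
    define M where "M = {x \<in> carrier G. h x \<in> N}"
    have M: "M \<lhd> G" "openin (topo G) M"
      using cont_hom_preimage_open_normal[OF Gf H h N] by (simp_all add: M_def)
    have MD: "x \<in> carrier G" "h x \<in> N" if "x \<in> M" for x using that by (simp_all add: M_def)
    interpret M: normal M G by (rule M(1))
    have solv: "solvable (G Mod M)" using G M unfolding prosoluble_group_def by blast
    have g: "group_hom G (H Mod N) (\<lambda>x. N #>\<^bsub>H\<^esub> h x)"
      using f.H.is_group h.G.is_group hom_compose[OF h.homh f.homh]
      by (simp add: group_hom_def group_hom_axioms_def o_def)
    have g_surj: "(\<lambda>x. N #>\<^bsub>H\<^esub> h x) ` carrier G = carrier (H Mod N)"
      by (simp only: carrier_FactGroup surj[symmetric] image_image)
    have "M \<subseteq> kernel G (H Mod N) (\<lambda>x. N #>\<^bsub>H\<^esub> h x)"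
    proof (rule subsetI)
      fix x assume x: "x \<in> M"
      have "N #>\<^bsub>H\<^esub> h x = N"
        by (rule H.coset_join2[OF h.hom_closed[OF MD(1)[OF x]] N.subgroup_axioms MD(2)[OF x]])
      then show "x \<in> kernel G (H Mod N) (\<lambda>x. N #>\<^bsub>H\<^esub> h x)" using MD(1)[OF x] by (simp add: kernel_def)
    qed
    then have ker: "kernel G (G Mod M) (\<lambda>x. M #>\<^bsub>G\<^esub> x) \<subseteq> kernel G (H Mod N) (\<lambda>x. N #>\<^bsub>H\<^esub> h x)"
      by (simp only: M.kernel_FactGroup_hom)
    show "solvable (H Mod N)"
      by (rule group_hom.solvable_of_kernel_subset[OF M.FactGroup_group_hom g g_surj ker solv])
  qed
qed

text \<open>An open normal \<open>N\<close> in \<open>R\<close> contains the trace on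
  \<open>R\<close> of some open normal \<open>M\<close> of \<open>G\<close>, so \<open>R / N\<close>
  is a quotient of the image of \<open>R\<close> in \<open>G / M\<close>.\<close>

lemma prosoluble_closed_subgroup:
  assumes G: "prosoluble_group G" and R: "closed_subgroup R G"
  shows "prosoluble_group (sub_top_group G R)"
proof -
  interpret G: profinite_group G using G prosoluble_groupD by blast
  interpret R: profinite_group "sub_top_group G R" by (rule G.profinite_sub[OF R])
  have Rs: "subgroup R G" using R closed_subgroup_def by blast
  then have RG: "R \<subseteq> carrier G" using subgroup.subset by blast
  show ?thesis
  proof (rule R.prosolubleI)
    fix N assume N: "N \<lhd> sub_top_group G R" "openin (topo (sub_top_group G R)) N"
    interpret N: normal N "sub_top_group G R" by (rule N(1))
    obtain U where U: "openin (topo G) U" "N = U \<inter> R" using N(2) by (auto simp: openin_subtopology)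
    have "\<one>\<^bsub>G\<^esub> \<in> U" using N.one_closed U by auto
    then obtain M where M: "M \<lhd> G" "openin (topo G) M" "M \<subseteq> U"
      using G.open_normal_subgroup_basis U(1) by metis
    interpret M: normal M G by (rule M(1))
    interpret f: group_hom "sub_top_group G R" "G Mod M" "\<lambda>x. M #>\<^bsub>G\<^esub> x"
    proof (intro group_hom.intro group_hom_axioms.intro homI)
      fix x y assume "x \<in> carrier (sub_top_group G R)" "y \<in> carrier (sub_top_group G R)"
      then have "x \<in> carrier G" "y \<in> carrier G" using RG by auto
      then show "M #>\<^bsub>G\<^esub> (x \<otimes>\<^bsub>sub_top_group G R\<^esub> y) = (M #>\<^bsub>G\<^esub> x) \<otimes>\<^bsub>G Mod M\<^esub> (M #>\<^bsub>G\<^esub> y)"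
        using hom_mult[OF M.r_coset_hom_Mod] by simp
    qed (use R.is_group M.factorgroup_is_group RG in \<open>auto simp: carrier_FactGroup\<close>)
    have "kernel (sub_top_group G R) (G Mod M) (\<lambda>x. M #>\<^bsub>G\<^esub> x) \<subseteq> N"
      using M.kernel_FactGroup_hom RG M(3) U(2) by (auto simp: kernel_def)
    moreover have "solvable (G Mod M)" using G M unfolding prosoluble_group_def by blast
    ultimately show "solvable (sub_top_group G R Mod N)"
      using f.solvable_of_kernel_subset[OF N.FactGroup_group_hom] N.kernel_FactGroup_hom
      by (simp add: carrier_FactGroup)
  qed
qed

section \<open>Prosolubility and existence of minimal closed supplements\<close>

text \<open>Minimality descends to each finite quotient \<open>S / N\<close> over
  \<open>C / \<pi>(N)\<close>, since a supplement there pulls back to a closed one in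
  \<open>S\<close>; \<open>minimal_supplement_solvable\<close> then applies.\<close>

lemma prosoluble_of_minimal_supplement:
  assumes p: "Factorial_Ring.prime p" and A: "pro_p_group p A" and i: "i \<in> cont_hom A S"
    and S: "profinite_group S" and C: "prosoluble_group C"
    and \<pi>: "\<pi> \<in> cont_hom S C" and surj: "\<pi> ` carrier S = carrier C"
    and minimal: "\<And>T. closed_subgroup T S \<Longrightarrow> i ` carrier A \<subseteq> T \<Longrightarrow> \<pi> ` T = carrier C \<Longrightarrow> T = carrier S"
  shows "prosoluble_group S"
proof -
  interpret S: profinite_group S by (rule S)
  have Cf: "profinite_group C" using C prosoluble_groupD by blast
  interpret C: profinite_group C by (rule Cf)
  have Af: "profinite_group A" using A pro_p_groupD by blast
  interpret A: profinite_group A by (rule Af)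
  interpret \<pi>: group_hom S C \<pi> by (rule cont_hom_group_hom[OF S Cf \<pi>])
  interpret i: group_hom A S i by (rule cont_hom_group_hom[OF Af S i])
  show ?thesis
  proof (rule S.prosolubleI)
    fix N assume N: "N \<lhd> S" "openin (topo S) N"
    interpret N: normal N S by (rule N(1))
    interpret f: group_hom S "S Mod N" "\<lambda>x. N #>\<^bsub>S\<^esub> x" by (rule N.FactGroup_group_hom)
    let ?D = "\<pi> ` N"
    have D: "?D \<lhd> C" by (rule N.surj_hom_normal_subgroup[OF \<pi>.group_hom_axioms surj])
    interpret D: normal ?D C by (rule D)
    interpret d: group_hom C "C Mod ?D" "\<lambda>x. ?D #>\<^bsub>C\<^esub> x" by (rule D.FactGroup_group_hom)
    have "openin (topo S) {x \<in> topspace (topo S). \<pi> x \<in> ?D}"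
    proof (rule S.openin_supergroup[OF N(2) N.subgroup_axioms])
      show "subgroup {x \<in> topspace (topo S). \<pi> x \<in> ?D} S"
        using \<pi>.subgroup_preimage[OF D.subgroup_axioms] S.topspace_topo by simp
    qed (use N.subset S.topspace_topo in auto)
    \<comment> \<open>A continuous surjection from a compact to a Hausdorff space is a quotient map,
      so openness of the preimage of \<open>?D\<close>, which contains \<open>N\<close>, makes
      \<open>?D\<close> itself open.\<close>
    moreover have "quotient_map (topo S) (topo C) \<pi>"
      using \<pi> surj S.compact C.Hausdorff S.topspace_topo C.topspace_topo
      by (intro continuous_imp_quotient_map) (auto simp: cont_hom_def)
    ultimately have "openin (topo C) ?D"
      using D.subset C.topspace_topo unfolding quotient_map_def by blast
    then have Q: "solvable (C Mod ?D)" using C D unfolding prosoluble_group_def by blast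
    have \<rho>: "(\<lambda>x. ?D #>\<^bsub>C\<^esub> \<pi> x) \<in> hom S (C Mod ?D)"
      using hom_compose[OF \<pi>.homh d.homh] by (simp add: o_def)
    have "?D #>\<^bsub>C\<^esub> \<pi> x = ?D #>\<^bsub>C\<^esub> \<pi> y"
      if xy: "x \<in> carrier S" "y \<in> carrier S" "N #>\<^bsub>S\<^esub> x = N #>\<^bsub>S\<^esub> y" for x y
    proof -
      have "x \<otimes>\<^bsub>S\<^esub> inv\<^bsub>S\<^esub> y \<in> N" using N.r_coset_eq_iff xy by blast
      then have "\<pi> (x \<otimes>\<^bsub>S\<^esub> inv\<^bsub>S\<^esub> y) \<in> ?D" by blast
      then have "\<pi> x \<otimes>\<^bsub>C\<^esub> inv\<^bsub>C\<^esub> \<pi> y \<in> ?D" using xy by simp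
      then show ?thesis using D.r_coset_eq_iff xy by simp
    qed
    \<comment> \<open>\<open>\<alpha>\<close> is the map induced by \<open>\<pi>\<close> on
      quotients; it is well defined because \<open>\<pi>\<close> sends \<open>N\<close> into
      \<open>?D\<close>.\<close>
    then obtain \<alpha> where \<alpha>: "\<alpha> \<in> hom (S Mod N) (C Mod ?D)"
      "\<And>x. x \<in> carrier S \<Longrightarrow> \<alpha> (N #>\<^bsub>S\<^esub> x) = ?D #>\<^bsub>C\<^esub> \<pi> x"
      using FactGroup_universal[OF \<rho> N(1)] by blast
    interpret \<alpha>: group_hom "S Mod N" "C Mod ?D" \<alpha>
      using \<alpha>(1) by unfold_locales
    let ?A = "(\<lambda>x. N #>\<^bsub>S\<^esub> i x) ` carrier A"
    interpret a: group_hom A "S Mod N" "\<lambda>x. N #>\<^bsub>S\<^esub> i x"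
      using hom_compose[OF i.homh f.homh] by unfold_locales (simp add: o_def)
    let ?M = "{x \<in> carrier A. i x \<in> N}"
    have M: "?M \<lhd> A" "openin (topo A) ?M" using cont_hom_preimage_open_normal[OF Af S i N] by auto
    have kerA: "kernel A (S Mod N) (\<lambda>x. N #>\<^bsub>S\<^esub> i x) = ?M"
      using N.kernel_FactGroup_hom i.hom_closed unfolding kernel_def by blast
    \<comment> \<open>The image of \<open>A\<close> in \<open>S / N\<close> has as many elements as
      the quotient of \<open>A\<close> by the open subgroup \<open>?M\<close>, a power of
      \<open>p\<close> as \<open>A\<close> is pro-p.\<close>
    obtain k where "order (A Mod ?M) = p ^ k" using A M unfolding pro_p_group_def by blast
    then have cardA: "card ?A = p ^ k"
      using a.card_hom_image unfolding kerA by (simp add: order_def FactGroup_def)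
    show "solvable (S Mod N)"
    proof (rule \<alpha>.minimal_supplement_solvable[OF _ _ Q p _ cardA])
      show "finite (carrier (S Mod N))"
        using S.finite_rcosets_open[OF N(2) N.subgroup_axioms] by (simp add: FactGroup_def)
      have "\<alpha> ` carrier (S Mod N) = (\<lambda>x. ?D #>\<^bsub>C\<^esub> \<pi> x) ` carrier S"
        unfolding carrier_FactGroup image_image using \<alpha>(2) by (rule image_cong[OF refl])
      also have "\<dots> = carrier (C Mod ?D)"
        unfolding carrier_FactGroup surj[symmetric] image_image ..
      finally show "\<alpha> ` carrier (S Mod N) = carrier (C Mod ?D)" .
      show "subgroup ?A (S Mod N)" by (rule a.img_is_subgroup)
      fix T' assume T': "subgroup T' (S Mod N)" "?A \<subseteq> T'" "\<alpha> ` T' = carrier (C Mod ?D)"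
      \<comment> \<open>The preimage of \<open>T'\<close> contains the open subgroup
        \<open>N\<close>, so it is open and therefore closed.\<close>
      let ?T = "{x \<in> carrier S. N #>\<^bsub>S\<^esub> x \<in> T'}"
      have T: "subgroup ?T S" by (rule f.subgroup_preimage[OF T'(1)])
      have NT: "N \<subseteq> ?T"
      proof
        fix x assume "x \<in> N"
        moreover from this have "N #>\<^bsub>S\<^esub> x = N"
          by (intro S.coset_join2[OF _ N.subgroup_axioms]) auto
        ultimately show "x \<in> ?T" using subgroup.one_closed[OF T'(1)] by simp
      qed
      have "closed_subgroup ?T S"
        using S.closedin_open_subgroup[OF S.openin_supergroup[OF N(2) N.subgroup_axioms T NT] T] T
        by (simp add: closed_subgroup_def)
      moreover have "i ` carrier A \<subseteq> ?T" using T'(2) by auto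
      moreover have "\<pi> ` ?T = carrier C"
      proof
        show "carrier C \<subseteq> \<pi> ` ?T"
        proof
          fix c assume c: "c \<in> carrier C"
          then have "?D #>\<^bsub>C\<^esub> c \<in> \<alpha> ` T'" using T'(3) carrier_FactGroup by blast
          then obtain t' where t': "t' \<in> T'" "\<alpha> t' = ?D #>\<^bsub>C\<^esub> c" by auto
          then obtain t where t: "t \<in> carrier S" "t' = N #>\<^bsub>S\<^esub> t"
            using subgroup.subset[OF T'(1)] unfolding carrier_FactGroup by blast
          then have "?D #>\<^bsub>C\<^esub> c = ?D #>\<^bsub>C\<^esub> \<pi> t" using \<alpha>(2) t'(2) by simp
          then have "c \<otimes>\<^bsub>C\<^esub> inv\<^bsub>C\<^esub> \<pi> t \<in> ?D" using D.r_coset_eq_iff[of c "\<pi> t"] c t(1) by simp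
          then obtain n where n: "n \<in> N" "c \<otimes>\<^bsub>C\<^esub> inv\<^bsub>C\<^esub> \<pi> t = \<pi> n" by blast
          have "c = (c \<otimes>\<^bsub>C\<^esub> inv\<^bsub>C\<^esub> \<pi> t) \<otimes>\<^bsub>C\<^esub> \<pi> t" using c t(1) by (simp add: C.m_assoc)
          also have "\<dots> = \<pi> (n \<otimes>\<^bsub>S\<^esub> t)" using n t(1) by simp
          finally have "c = \<pi> (n \<otimes>\<^bsub>S\<^esub> t)" .
          moreover have "n \<otimes>\<^bsub>S\<^esub> t \<in> ?T"
            using subgroup.m_closed[OF T] NT n(1) t t'(1) by blast
          ultimately show "c \<in> \<pi> ` ?T" by blast
        qed
      qed auto
      ultimately have TS: "?T = carrier S" by (rule minimal)
      have "carrier (S Mod N) \<subseteq> T'"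
        unfolding carrier_FactGroup using TS by blast
      then show "T' = carrier (S Mod N)" using subgroup.subset[OF T'(1)] by blast
    qed
  qed
qed

text \<open>Zorn's lemma. The point to check is that the intersection of a chain still maps onto
  \<open>C\<close>: its members meet a given fibre of \<open>\<pi>\<close> in closed sets with the
  finite intersection property, and \<open>G\<close> is compact.\<close>

lemma minimal_closed_supplement:
  assumes G: "profinite_group G" and C: "profinite_group C" and \<pi>: "\<pi> \<in> cont_hom G C"
    and surj: "\<pi> ` carrier G = carrier C" and E: "E \<subseteq> carrier G"
  obtains S where "closed_subgroup S G" "E \<subseteq> S" "\<pi> ` S = carrier C"
    "\<And>T. closed_subgroup T G \<Longrightarrow> E \<subseteq> T \<Longrightarrow> \<pi> ` T = carrier C \<Longrightarrow> T \<subseteq> S \<Longrightarrow> T = S"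
proof -
  interpret G: profinite_group G by (rule G)
  interpret C: profinite_group C by (rule C)
  interpret \<pi>: group_hom G C \<pi> by (rule cont_hom_group_hom[OF G C \<pi>])
  define \<S> where "\<S> = {S. closed_subgroup S G \<and> E \<subseteq> S \<and> \<pi> ` S = carrier C}"
  have SG: "S \<subseteq> carrier G" if "S \<in> \<S>" for S
    using that subgroup.subset unfolding \<S>_def closed_subgroup_def by blast
  have fibre: "closedin (topo G) {x \<in> carrier G. \<pi> x = c}" if "c \<in> carrier C" for c
    using closedin_continuous_map_preimage[of "topo G" "topo C" \<pi> "{c}"] \<pi> that
      closedin_Hausdorff_singleton[OF C.Hausdorff] G.topspace_topo C.topspace_topo
    by (simp add: cont_hom_def)
  have Inter: "\<Inter>\<C> \<in> \<S>" if chain: "\<C> \<noteq> {}" "\<C> \<subseteq> \<S>" "\<And>X Y. X \<in> \<C> \<Longrightarrow> Y \<in> \<C> \<Longrightarrow> X \<subseteq> Y \<or> Y \<subseteq> X" for \<C>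
  proof -
    have closed: "closedin (topo G) S" "subgroup S G" if "S \<in> \<C>" for S
      using that chain(2) by (auto simp: \<S>_def closed_subgroup_def)
    have "closed_subgroup (\<Inter>\<C>) G"
      unfolding closed_subgroup_def using G.subgroups_Inter[OF closed(2) chain(1)]
        closedin_Inter[OF chain(1)] closed(1) by blast
    moreover have "E \<subseteq> \<Inter>\<C>" using chain(2) by (auto simp: \<S>_def)
    moreover have "carrier C \<subseteq> \<pi> ` \<Inter>\<C>"
    proof
      fix c assume c: "c \<in> carrier C"
      let ?F = "\<lambda>S. S \<inter> {x \<in> carrier G. \<pi> x = c}"
      have "\<Inter>(?F ` \<C>) \<noteq> {}"
      proof (rule compact_space_fip[THEN iffD1, OF G.compact, rule_format], intro conjI allI ballI impI)
        show "closedin (topo G) K" if "K \<in> ?F ` \<C>" for K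
          using that closed(1) fibre[OF c] by auto
        fix \<F> assume F: "finite \<F> \<and> \<F> \<subseteq> ?F ` \<C>"
        then obtain \<D> where D: "\<D> \<subseteq> \<C>" "finite \<D>" "\<F> = ?F ` \<D>"
          by (meson finite_subset_image)
        show "\<Inter>\<F> \<noteq> {}"
        proof (cases "\<D> = {}")
          case True
          \<comment> \<open>The intersection of the empty family is \<open>UNIV\<close>.\<close>
          then show ?thesis using D by simp
        next
          case False
          have "subset.chain \<S> \<D>" using D(1) chain(2,3) unfolding subset_chain_def by blast
          \<comment> \<open>A finite nonempty chain contains its intersection, and every member
            meets the fibre.\<close>
          then have m: "\<Inter>\<D> \<in> \<D>" using Inter_in_chain[OF D(2) False] by blast
          then have "\<Inter>\<D> \<in> \<S>" using D(1) chain(2) by blast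
          then have "\<pi> ` \<Inter>\<D> = carrier C" by (simp add: \<S>_def)
          then obtain x where x: "x \<in> \<Inter>\<D>" "\<pi> x = c" by (metis c imageE)
          then have "x \<in> \<Inter>\<F>" using D SG m chain(2) by auto
          then show ?thesis by blast
        qed
      qed
      then obtain x where "x \<in> \<Inter>(?F ` \<C>)" by blast
      then have "x \<in> \<Inter>\<C>" "\<pi> x = c" using chain(1) by auto
      then show "c \<in> \<pi> ` \<Inter>\<C>" by blast
    qed
    moreover have "\<pi> ` \<Inter>\<C> \<subseteq> carrier C"
      using chain(1,2) SG \<pi>.hom_closed by blast
    ultimately show ?thesis by (simp add: \<S>_def)
  qed
  have "carrier G \<in> \<S>"
    using E surj G.closed_subgroup_carrier by (simp add: \<S>_def)
  \<comment> \<open>Zorn's lemma is applied to the complements, since we want a minimal element.\<close>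
  define \<U> where "\<U> = (\<lambda>S. carrier G - S) ` \<S>"
  have "\<exists>M\<in>\<U>. \<forall>X\<in>\<U>. M \<subseteq> X \<longrightarrow> X = M"
  proof (rule subset_Zorn_nonempty)
    show "\<U> \<noteq> {}" using \<open>carrier G \<in> \<S>\<close> by (auto simp: \<U>_def)
    fix \<B> assume B: "\<B> \<noteq> {}" "subset.chain \<U> \<B>"
    define \<C> where "\<C> = (\<lambda>U. carrier G - U) ` \<B>"
    have BU: "\<B> \<subseteq> \<U>" using B(2) by (simp add: subset_chain_def)
    have "\<C> \<subseteq> \<S>"
    proof
      fix X assume "X \<in> \<C>"
      then obtain S where S: "S \<in> \<S>" "X = carrier G - (carrier G - S)" using BU by (auto simp: \<C>_def \<U>_def)
      then have "X = S" using SG by blast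
      then show "X \<in> \<S>" using S by simp
    qed
    moreover have "\<C> \<noteq> {}" using B by (simp add: \<C>_def)
    moreover have "X \<subseteq> Y \<or> Y \<subseteq> X" if "X \<in> \<C>" "Y \<in> \<C>" for X Y
      using that B(2) unfolding \<C>_def subset_chain_def by blast
    ultimately have "\<Inter>\<C> \<in> \<S>" using Inter by blast
    moreover have "\<Union>\<B> = carrier G - \<Inter>\<C>"
      using B(1) BU by (auto simp: \<C>_def \<U>_def)
    ultimately show "\<Union>\<B> \<in> \<U>" by (simp add: \<U>_def)
  qed
  then obtain S where S: "S \<in> \<S>" and max: "\<And>T. T \<in> \<S> \<Longrightarrow> carrier G - S \<subseteq> carrier G - T \<Longrightarrow> carrier G - T = carrier G - S"
    by (auto simp: \<U>_def)
  show ?thesis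
  proof (rule that)
    show "closed_subgroup S G" "E \<subseteq> S" "\<pi> ` S = carrier C" using S by (auto simp: \<S>_def)
    fix T assume T: "closed_subgroup T G" "E \<subseteq> T" "\<pi> ` T = carrier C" "T \<subseteq> S"
    then have "T \<in> \<S>" by (simp add: \<S>_def)
    moreover from this have "carrier G - T = carrier G - S" using max T(4) by blast
    ultimately show "T = S" using SG S by blast
  qed
qed

section \<open>Consequences of the universal property of coproducts\<close>

lemma is_coproductD:
  assumes "is_coproduct \<C> A B G i j"
  shows "\<C> A" "\<C> B" "\<C> G" "i \<in> cont_hom A G" "j \<in> cont_hom B G"
  by (insert assms, unfold is_coproduct_def, (elim conjE, assumption)+)

lemma is_coproductE:
  assumes coprod: "is_coproduct \<C> A B G i j" and "\<C> H" "f \<in> cont_hom A H" "g \<in> cont_hom B H"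
  obtains \<phi> where "\<phi> \<in> cont_hom G H" "\<And>a. a \<in> carrier A \<Longrightarrow> \<phi> (i a) = f a"
    "\<And>b. b \<in> carrier B \<Longrightarrow> \<phi> (j b) = g b"
proof -
  from coprod[unfolded is_coproduct_def, THEN conjunct2, THEN conjunct2, THEN conjunct2,
      THEN conjunct2, THEN conjunct2, THEN spec[of _ H], THEN spec[of _ f], THEN spec[of _ g],
      THEN mp, OF conjI[OF assms(2) conjI[OF assms(3,4)]]]
  show ?thesis
    by (elim bexE conjE) (rule that, assumption, erule bspec, assumption, erule bspec, assumption)
qed

text \<open>Both \<open>\<theta>\<close> and the identity solve the universal problem posed by
  \<open>i\<close> and \<open>j\<close> themselves, so uniqueness identifies them.\<close>

lemma is_coproduct_endo_id:
  assumes coprod: "is_coproduct \<C> A B G i j" and \<theta>: "\<theta> \<in> cont_hom G G"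
    and i: "\<And>a. a \<in> carrier A \<Longrightarrow> \<theta> (i a) = i a" and j: "\<And>b. b \<in> carrier B \<Longrightarrow> \<theta> (j b) = j b"
    and x: "x \<in> carrier G"
  shows "\<theta> x = x"
proof -
  note G = is_coproductD[OF coprod]
  from coprod[unfolded is_coproduct_def, THEN conjunct2, THEN conjunct2, THEN conjunct2,
      THEN conjunct2, THEN conjunct2, THEN spec[of _ G], THEN spec[of _ i], THEN spec[of _ j],
      THEN mp, OF conjI[OF G(3) conjI[OF G(4,5)]]]
  obtain \<phi> where \<phi>: "\<forall>\<psi> \<in> cont_hom G G. (\<forall>a \<in> carrier A. \<psi> (i a) = i a) \<and> (\<forall>b \<in> carrier B. \<psi> (j b) = j b)
      \<longrightarrow> (\<forall>x \<in> carrier G. \<psi> x = \<phi> x)"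
    by (elim bexE conjE) (rule that, assumption)
  have "(\<lambda>x. x) \<in> cont_hom G G" by (simp add: cont_hom_def hom_def)
  then have "x = \<phi> x" using \<phi>[THEN bspec[of _ _ "\<lambda>x. x"]] x by simp
  moreover have "\<theta> x = \<phi> x" using \<phi>[THEN bspec[OF _ \<theta>]] i j x by simp
  ultimately show ?thesis by simp
qed

text \<open>The structure maps factor through \<open>R\<close>, which induces a map from
  \<open>G\<close> to \<open>R\<close>. Followed by the inclusion it is the identity, so
  \<open>R\<close> is everything.\<close>

lemma coproduct_generated:
  assumes coprod: "is_coproduct \<C> A B G i j" and R: "closed_subgroup R G" "\<C> (sub_top_group G R)"
    and AB: "topological_group A" "topological_group B"
    and i: "i ` carrier A \<subseteq> R" and j: "j ` carrier B \<subseteq> R"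
  shows "R = carrier G"
proof -
  have RG: "R \<subseteq> carrier G" using R subgroup.subset unfolding closed_subgroup_def by blast
  note ij = is_coproductD(4,5)[OF coprod]
  obtain \<theta> where \<theta>: "\<theta> \<in> cont_hom G (sub_top_group G R)"
    "\<And>a. a \<in> carrier A \<Longrightarrow> \<theta> (i a) = i a" "\<And>b. b \<in> carrier B \<Longrightarrow> \<theta> (j b) = j b"
    using is_coproductE[OF coprod R(2) cont_hom_into_sub[OF ij(1) i AB(1)] cont_hom_into_sub[OF ij(2) j AB(2)]]
    by blast
  have "\<theta> x = x" if "x \<in> carrier G" for x
    by (rule is_coproduct_endo_id[OF coprod cont_hom_sub_into[OF \<theta>(1) RG] \<theta>(2,3) that])
  moreover have "\<theta> x \<in> R" if "x \<in> carrier G" for x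
    using \<theta>(1) that by (auto simp: cont_hom_def hom_def)
  ultimately show ?thesis using RG by force
qed

section \<open>Construction of the section and of the retract\<close>

theorem corollary5p2:
  fixes p :: nat
    and A P G Gs :: "'u top_group"
    and iA iP jA jP :: "'u \<Rightarrow> 'u"
  assumes "infinite (UNIV :: 'u set)"
    and "Factorial_Ring.prime p"
    and "pro_p_group p A"
    and "prosoluble_group P"
    and "projective_group P"
    and "is_coproduct profinite_group A P G iA iP"
    and "is_coproduct prosoluble_group A P Gs jA jP"
  shows "\<exists>R. retract_of_group R G \<and> prosoluble_group (sub_top_group G R)
           \<and> top_iso (sub_top_group G R) Gs"
proof -
  have G: "profinite_group G" and Af: "profinite_group A" and Pf: "profinite_group P"
    and iA: "iA \<in> cont_hom A G" and iP: "iP \<in> cont_hom P G"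
    by (fact is_coproductD[OF assms(6)])+
  have Gs: "prosoluble_group Gs" and jA: "jA \<in> cont_hom A Gs" and jP: "jP \<in> cont_hom P Gs"
    by (fact is_coproductD[OF assms(7)])+
  have Gsf: "profinite_group Gs" using Gs prosoluble_groupD by blast
  interpret G: profinite_group G by (rule G)
  interpret Gs: profinite_group Gs by (rule Gsf)
  interpret A: profinite_group A by (rule Af)
  interpret P: profinite_group P by (rule Pf)
  \<comment> \<open>\<open>Gs\<close> is in particular profinite, so the universal property of
    \<open>G\<close> applies to its structure maps.\<close>
  obtain \<pi> where \<pi>: "\<pi> \<in> cont_hom G Gs" and \<pi>A: "\<And>a. a \<in> carrier A \<Longrightarrow> \<pi> (iA a) = jA a"
    and \<pi>P: "\<And>b. b \<in> carrier P \<Longrightarrow> \<pi> (iP b) = jP b"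
    using is_coproductE[OF assms(6) Gsf jA jP] by blast
  interpret \<pi>: group_hom G Gs \<pi> by (rule cont_hom_group_hom[OF G Gsf \<pi>])
  have iA_closed: "iA a \<in> carrier G" if "a \<in> carrier A" for a
    using iA that by (auto simp: cont_hom_def hom_def)
  have iP_closed: "iP b \<in> carrier G" if "b \<in> carrier P" for b
    using iP that by (auto simp: cont_hom_def hom_def)
  have I: "closed_subgroup (\<pi> ` carrier G) Gs"
    by (rule cont_hom_image_closed_subgroup[OF G Gsf \<pi> G.closed_subgroup_carrier])
  \<comment> \<open>The image is a closed, hence prosoluble, subgroup containing the images of
    \<open>A\<close> and \<open>P\<close>; inside the prosoluble coproduct such a subgroup is
    everything.\<close>
  have surj: "\<pi> ` carrier G = carrier Gs"
  proof (rule coproduct_generated[OF assms(7) I prosoluble_closed_subgroup[OF Gs I]])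
    show "jA ` carrier A \<subseteq> \<pi> ` carrier G"
      using \<pi>A iA_closed by (metis image_eqI image_subsetI)
    show "jP ` carrier P \<subseteq> \<pi> ` carrier G"
      using \<pi>P iP_closed by (metis image_eqI image_subsetI)
  qed unfold_locales
  have "iA ` carrier A \<subseteq> carrier G" using iA_closed by blast
  then obtain S where S: "closed_subgroup S G" "iA ` carrier A \<subseteq> S" "\<pi> ` S = carrier Gs"
    and min: "\<And>T. closed_subgroup T G \<Longrightarrow> iA ` carrier A \<subseteq> T \<Longrightarrow> \<pi> ` T = carrier Gs \<Longrightarrow> T \<subseteq> S \<Longrightarrow> T = S"
    using minimal_closed_supplement[OF G Gsf \<pi> surj] by metis
  let ?S = "sub_top_group G S"
  have Ssub: "subgroup S G" using S(1) by (simp add: closed_subgroup_def)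
  then have SG: "S \<subseteq> carrier G" using subgroup.subset by blast
  have Sf: "profinite_group ?S" by (rule G.profinite_sub[OF S(1)])
  have iAS: "iA \<in> cont_hom A ?S" by (rule cont_hom_into_sub[OF iA S(2) A.topological_group_axioms])
  have \<pi>S: "\<pi> \<in> cont_hom ?S Gs" by (rule cont_hom_from_sub[OF \<pi> Ssub])
  have Ss: "prosoluble_group ?S"
  proof (rule prosoluble_of_minimal_supplement[OF assms(2,3) iAS Sf Gs \<pi>S])
    show "\<pi> ` carrier ?S = carrier Gs" using S(3) by simp
    \<comment> \<open>Closed subgroups of \<open>S\<close> are closed in \<open>G\<close>, so
      minimality among subgroups of \<open>G\<close> carries over.\<close>
    fix T assume T: "closed_subgroup T ?S" "iA ` carrier A \<subseteq> T" "\<pi> ` T = carrier Gs"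
    then show "T = carrier ?S"
      using min[of T] closed_subgroup_sub_top_group[OF G.is_group S(1) T(1)] by simp
  qed
  have "\<pi> ` carrier ?S = carrier Gs" using S(3) by simp
  moreover have "\<forall>B C \<alpha> \<phi>. profinite_group B \<and> profinite_group C \<and> \<alpha> \<in> cont_hom B C \<and>
      \<alpha> ` carrier B = carrier C \<and> \<phi> \<in> cont_hom P C \<longrightarrow>
      (\<exists>\<psi> \<in> cont_hom P B. \<forall>x \<in> carrier P. \<alpha> (\<psi> x) = \<phi> x)"
    using assms(5) unfolding projective_group_def by blast
  \<comment> \<open>Projectivity lifts \<open>jP\<close> through the restriction of
    \<open>\<pi>\<close> to \<open>S\<close>, which is onto \<open>Gs\<close>.\<close>
  ultimately have "\<exists>\<psi> \<in> cont_hom P ?S. \<forall>x \<in> carrier P. \<pi> (\<psi> x) = jP x"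
    using Sf Gsf \<pi>S jP by blast
  then obtain \<psi> where \<psi>: "\<psi> \<in> cont_hom P ?S" "\<forall>x\<in>carrier P. \<pi> (\<psi> x) = jP x"
    by blast
  \<comment> \<open>Prosolubility of \<open>S\<close> is what makes it an admissible target for the
    universal property of \<open>Gs\<close>.\<close>
  obtain \<sigma> where \<sigma>: "\<sigma> \<in> cont_hom Gs ?S" and \<sigma>A: "\<And>a. a \<in> carrier A \<Longrightarrow> \<sigma> (jA a) = iA a"
    and \<sigma>P: "\<And>b. b \<in> carrier P \<Longrightarrow> \<sigma> (jP b) = \<psi> b"
    using is_coproductE[OF assms(7) Ss iAS \<psi>(1)] by blast
  have \<sigma>G: "\<sigma> \<in> cont_hom Gs G" by (rule cont_hom_sub_into[OF \<sigma> SG])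
  \<comment> \<open>The composite fixes the images of \<open>A\<close> and \<open>P\<close> in
    \<open>Gs\<close>, so uniqueness makes it the identity.\<close>
  have \<pi>\<sigma>: "\<pi> (\<sigma> x) = x" if "x \<in> carrier Gs" for x
  proof -
    have "(\<pi> \<circ> \<sigma>) x = x"
      by (rule is_coproduct_endo_id[OF assms(7) cont_hom_compose[OF Gs.is_group \<sigma>G \<pi>] _ _ that])
        (use \<sigma>A \<sigma>P \<pi>A \<psi>(2) in simp_all)
    then show ?thesis by simp
  qed
  let ?R = "\<sigma> ` carrier Gs"
  have R: "closed_subgroup ?R G"
    by (rule cont_hom_image_closed_subgroup[OF Gsf G \<sigma>G Gs.closed_subgroup_carrier])
  then have Rsub: "subgroup ?R G" by (simp add: closed_subgroup_def)
  have Rf: "profinite_group (sub_top_group G ?R)" by (rule G.profinite_sub[OF R])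
  have \<sigma>R: "\<sigma> \<in> cont_hom Gs (sub_top_group G ?R)"
    by (rule cont_hom_into_sub[OF \<sigma>G subset_refl Gs.topological_group_axioms])
  have \<pi>R: "\<pi> \<in> cont_hom (sub_top_group G ?R) Gs"
    by (rule cont_hom_from_sub[OF \<pi> Rsub])
  have "retract_of_group ?R G"
    unfolding retract_of_group_def
  \<comment> \<open>The retraction is \<open>\<sigma> \<circ> \<pi>\<close>: on a point
    \<open>\<sigma> y\<close> of the image it returns \<open>\<sigma> y\<close>, because
    \<open>\<pi>\<close> undoes \<open>\<sigma>\<close>.\<close>
  proof (intro conjI bexI[of _ "\<sigma> \<circ> \<pi>"])
    show "\<forall>x\<in>?R. (\<sigma> \<circ> \<pi>) x = x" using \<pi>\<sigma> by auto
  qed (use R cont_hom_compose[OF G.is_group \<pi> \<sigma>R] in auto)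
  moreover have "prosoluble_group (sub_top_group G ?R)"
    by (rule prosoluble_continuous_image[OF Gs Rf \<sigma>R]) simp
  moreover have "top_iso (sub_top_group G ?R) Gs"
    unfolding top_iso_def
  proof (intro bexI conjI)
    have "homeomorphic_maps (topo (sub_top_group G ?R)) (topo Gs) \<pi> \<sigma>"
      using \<pi>R \<sigma>R \<pi>\<sigma> Gs.topspace_topo by (auto simp: homeomorphic_maps_def cont_hom_def)
    then show "homeomorphic_map (topo (sub_top_group G ?R)) (topo Gs) \<pi>"
      using homeomorphic_map_maps by blast
    have "bij_betw \<pi> ?R (carrier Gs)"
      using \<pi>\<sigma> \<sigma>G by (intro bij_betw_byWitness[where f' = \<sigma>]) auto
    then show "\<pi> \<in> iso (sub_top_group G ?R) Gs"
      using \<pi>R by (simp add: iso_def cont_hom_def)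
  qed
  ultimately show ?thesis by blast
qed

end
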